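(* The critical value of the $\mathrm{GN}_1(d,\alpha)$ model satisfies $\alpha_c(d)\to 1$ as $d\to\infty$.
   Context: Let $X$ be a homogeneous Poisson process on $\mathbb{R}^d$ (of some positive, finite density; the choice of density only rescales the model). For $x\in X$ let $d_1(x)$ be the Euclidean distance from $x$ to its nearest neighbour among the other points of $X$. For a real $\alpha\ge 0$, the model $\mathrm{GN}_1(d,\alpha)$ is the random undirected graph with vertex set $X$ in which each $x\in X$ is joined by an edge to every $y\in X$ with $y\ne x$ and $|x-y|\le r(x)$, where $r(x)=\alpha d_1(x)$ (so $x,y$ are adjacent iff $|x-y|\le r(x)$ or $|x-y|\le r(y)$). Let $U$ be the event that the graph has an infinite connected component. The critical value is $\alpha_c(d)=\inf\{\alpha\ge 0:\mathbb{P}(U)>0\}$ (with $\inf\emptyset=\infty$), where $\mathbb{P}(U)$ is computed in $\mathrm{GN}_1(d,\alpha)$. *)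

theory Defs
  imports "HOL-Probability.Probability"
begin

text \<open>
  The dimension has to vary inside the statement, so R^d is the carrier of the d-fold product of
  \<^const>\<open>lborel\<close>: extensional functions on \<open>{..<d}\<close>. Its measurable sets are the Borel sets of R^d
  and its measure is d-dimensional Lebesgue measure.
\<close>

abbreviation leb :: "nat \<Rightarrow> (nat \<Rightarrow> real) measure" where
  "leb d \<equiv> Pi\<^sub>M {..<d} (\<lambda>_. lborel)"

definition edist :: "nat \<Rightarrow> (nat \<Rightarrow> real) \<Rightarrow> (nat \<Rightarrow> real) \<Rightarrow> real" where
  "edist d x y = L2_set (\<lambda>i. x i - y i) {..<d}"

definition bounded_set :: "nat \<Rightarrow> (nat \<Rightarrow> real) set \<Rightarrow> bool" where
  "bounded_set d B \<longleftrightarrow> (\<exists>R. \<forall>x\<in>B. L2_set x {..<d} \<le> R)"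

definition bounded_borel :: "nat \<Rightarrow> (nat \<Rightarrow> real) set set" where
  "bounded_borel d = {B \<in> sets (leb d). bounded_set d B}"

text \<open>
  A process is a random locally finite subset \<open>X \<omega>\<close> of R^d. Local finiteness holds for every sample
  point, so all counts \<open>card (X \<omega> \<inter> B)\<close> with \<open>B\<close> bounded are genuine. The Poisson weights are
  written out because \<^const>\<open>poisson_pmf\<close> is only specified for positive rates and \<open>B\<close> may be a
  null set.
\<close>

definition homogeneous_poisson_process ::
  "nat \<Rightarrow> real \<Rightarrow> 'w measure \<Rightarrow> ('w \<Rightarrow> (nat \<Rightarrow> real) set) \<Rightarrow> bool" where
  "homogeneous_poisson_process d \<rho> M X \<longleftrightarrow>
     \<rho> > 0 \<and> prob_space M \<and>
     (\<forall>\<omega>\<in>space M. X \<omega> \<subseteq> space (leb d) \<and> (\<forall>B. bounded_set d B \<longrightarrow> finite (X \<omega> \<inter> B))) \<and>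
     (\<forall>B\<in>bounded_borel d.
        (\<lambda>\<omega>. card (X \<omega> \<inter> B)) \<in> measurable M (count_space UNIV) \<and>
        (\<forall>k. measure M {\<omega> \<in> space M. card (X \<omega> \<inter> B) = k} =
               (\<rho> * measure (leb d) B) ^ k / fact k * exp (- (\<rho> * measure (leb d) B)))) \<and>
     (\<forall>(n::nat) B. (\<forall>i<n. B i \<in> bounded_borel d) \<and> disjoint_family_on B {..<n} \<longrightarrow>
        prob_space.indep_vars M (\<lambda>_. count_space UNIV) (\<lambda>i \<omega>. card (X \<omega> \<inter> B i)) {..<n})"

definition nn_dist :: "nat \<Rightarrow> (nat \<Rightarrow> real) set \<Rightarrow> (nat \<Rightarrow> real) \<Rightarrow> real" where
  "nn_dist d V x = (INF y\<in>V - {x}. edist d x y)"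

definition GN1_edges ::
  "nat \<Rightarrow> real \<Rightarrow> (nat \<Rightarrow> real) set \<Rightarrow> ((nat \<Rightarrow> real) \<times> (nat \<Rightarrow> real)) set" where
  "GN1_edges d \<alpha> V = {(x, y). x \<in> V \<and> y \<in> V \<and> x \<noteq> y \<and>
     (edist d x y \<le> \<alpha> * nn_dist d V x \<or> edist d x y \<le> \<alpha> * nn_dist d V y)}"

definition components :: "'a set \<Rightarrow> ('a \<times> 'a) set \<Rightarrow> 'a set set" where
  "components V E = V // {(x, y). x \<in> V \<and> y \<in> V \<and> (x, y) \<in> E\<^sup>*}"

definition percolation_event ::
  "nat \<Rightarrow> real \<Rightarrow> 'w measure \<Rightarrow> ('w \<Rightarrow> (nat \<Rightarrow> real) set) \<Rightarrow> 'w set" where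
  "percolation_event d \<alpha> M X =
     {\<omega> \<in> space M. \<exists>C \<in> components (X \<omega>) (GN1_edges d \<alpha> (X \<omega>)). infinite C}"

text \<open>Extended reals, so that the infimum of the empty set is \<open>\<infinity>\<close>.\<close>

definition critical_value ::
  "nat \<Rightarrow> 'w measure \<Rightarrow> ('w \<Rightarrow> (nat \<Rightarrow> real) set) \<Rightarrow> ereal" where
  "critical_value d M X =
     Inf (ereal ` {\<alpha>. 0 \<le> \<alpha> \<and> measure M (percolation_event d \<alpha> M X) > 0})"

end

theory Submission
  imports Defs "HOL-Library.Function_Algebras" "HOL-Real_Asymp.Real_Asymp"
begin

text \<open>
  For \<open>\<alpha> < 1\<close> the graph has no edges. For \<open>\<alpha> = 1 + \<epsilon>\<close> and large \<open>d\<close>, cut space into small cubes, indexed by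
  the lattice. A cube is good if it contains exactly one point and the cubes within \<open>l\<close> steps of it
  are empty; the radius \<open>r\<close> of a good point is then so large that it reaches every point within \<open>t\<close> steps,
  where \<open>t / l\<close> is a constant larger than 1. Hence a ball of radius \<open>t\<close> has exponentially (in \<open>d\<close>) more cubes
  than one of radius \<open>l\<close>, and the size of the cubes can be chosen such that the former contains many points
  and the latter is nearly always empty.

  Consider paths of good cubes whose steps are made of a unit step in time (coordinate 0), a step of
  a random walk in the coordinates 1 to 4, and an arbitrary lattice vector of length at most \<open>t\<close> in the other
  coordinates, avoiding the neighbourhoods of the earlier cubes. The second moment method, applied
  to the number of such paths of length \<open>n\<close> from a fixed cube, bounds the probability of
  their existence from below uniformly in \<open>n\<close>: two paths can interact only while their
  walks in four dimensions are close to each other, and the difference of these walks is transient.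
\<close>

subsection \<open>Grid cells, distances and the lower bound\<close>

text \<open>The parameters come from a balance. With \<open>x\<close> cubes in the ball of radius
  \<open>l\<close> and \<open>y\<close> lattice vectors available for a step, a mean number \<kappa>
  of points per cube makes a void region cost about \<kappa> x and a coincidence of two paths about
  1 / (\<kappa> y); \<kappa> = 1 / sqrt (x y) makes both of order sqrt (x / y), exponentially small
  in \<open>d\<close>. Transience of the walk is paid for by the fourth power of the range within
  which two walks count as near. That range is a multiple of \<open>l\<close>, and \<open>l\<close>
  of order sqrt d / \<epsilon> is enough to make the diameter sqrt d of a cube negligible, so the
  price is polynomial in \<open>d\<close>.

  The obstacle is that the free coordinates carry no usable randomness: the steps there are an
  arbitrary selection that avoids earlier cubes. All decorrelation is therefore taken from the four
  walk coordinates, which the selection cannot influence because every walk step has equally many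
  extensions. The time coordinate lets a common cube occur only at equal indices of two paths, and
  common void only at nearby indices.\<close>

definition grid_cell :: "nat \<Rightarrow> real \<Rightarrow> (nat \<Rightarrow> int) \<Rightarrow> (nat \<Rightarrow> real) set" where
  "grid_cell d h c = {x \<in> space (leb d). \<forall>i<d. \<lfloor>x i / h\<rfloor> = c i}"

lemma grid_cell_eq_PiE:
  assumes "h > 0"
  shows "grid_cell d h c = Pi\<^sub>E {..<d} (\<lambda>i. {h * c i..<h * (c i + 1)})"
proof -
  have "\<lfloor>y / h\<rfloor> = k \<longleftrightarrow> y \<in> {h * k..<h * (k + 1)}" for y :: real and k :: int
    using assms by (simp add: floor_eq_iff field_simps)
  then show ?thesis
    by (auto simp: grid_cell_def space_PiM PiE_iff extensional_def)
qed

lemma edist_nonneg [simp]: "edist d x y \<ge> 0"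
  by (simp add: edist_def L2_set_nonneg)

lemma edist_commute: "edist d x y = edist d y x"
  by (simp add: edist_def L2_set_def power2_commute)

lemma edist_self [simp]: "edist d x x = 0"
  by (simp add: edist_def L2_set_def)

lemma edist_eq_0_iff:
  assumes "x \<in> space (leb d)" "y \<in> space (leb d)"
  shows "edist d x y = 0 \<longleftrightarrow> x = y"
proof
  assume "edist d x y = 0"
  then have "\<forall>i<d. x i = y i"
    by (simp add: edist_def L2_set_eq_0_iff)
  then show "x = y"
    using assms by (auto simp: space_PiM intro: PiE_ext)
qed simp

lemma grid_cell_bounded_borel:
  assumes "h > 0"
  shows "grid_cell d h c \<in> bounded_borel d"
proof -
  have "grid_cell d h c \<in> sets (leb d)"
    unfolding grid_cell_eq_PiE[OF assms] by (intro sets_PiM_I_finite) auto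
  moreover have "bounded_set d (grid_cell d h c)"
    unfolding bounded_set_def
  proof (intro exI ballI)
    fix x assume x: "x \<in> grid_cell d h c"
    have "L2_set x {..<d} \<le> (\<Sum>i<d. \<bar>x i\<bar>)"
      by (rule L2_set_le_sum_abs)
    also have "\<dots> \<le> (\<Sum>i<d. h * (\<bar>real_of_int (c i)\<bar> + 1))"
    proof (rule sum_mono)
      fix i assume "i \<in> {..<d}"
      then have "h * c i \<le> x i" "x i < h * (c i + 1)"
        using x unfolding grid_cell_eq_PiE[OF assms] by (auto simp: PiE_iff)
      moreover have "h * - \<bar>real_of_int (c i)\<bar> \<le> h * c i" "h * c i \<le> h * \<bar>real_of_int (c i)\<bar>"
        using assms by (intro mult_left_mono; simp)+
      ultimately show "\<bar>x i\<bar> \<le> h * (\<bar>real_of_int (c i)\<bar> + 1)"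
        using assms unfolding distrib_left mult_minus_right mult_1_right of_int_add of_int_1 by linarith
    qed
    finally show "L2_set x {..<d} \<le> (\<Sum>i<d. h * (\<bar>real_of_int (c i)\<bar> + 1))" .
  qed
  ultimately show ?thesis by (simp add: bounded_borel_def)
qed

lemma measure_grid_cell:
  assumes "h > 0"
  shows "measure (leb d) (grid_cell d h c) = h ^ d"
proof -
  interpret product_sigma_finite "\<lambda>_::nat. lborel :: real measure" ..
  have "emeasure (leb d) (grid_cell d h c) = (\<Prod>i<d. ennreal h)"
    unfolding grid_cell_eq_PiE[OF assms] using assms
    by (subst emeasure_PiM) (auto simp: algebra_simps)
  then show ?thesis
    using assms by (simp add: measure_def ennreal_power)
qed

section \<open>Edges without infima, and the absence of edges below 1\<close>

definition locally_finite :: "nat \<Rightarrow> (nat \<Rightarrow> real) set \<Rightarrow> bool" where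
  "locally_finite d V \<longleftrightarrow> V \<subseteq> space (leb d) \<and> (\<forall>B. bounded_set d B \<longrightarrow> finite (V \<inter> B))"

text \<open>Removes the infimum. Dividing by \<open>\<alpha>\<close> leaves a lower bound for an
  infimum of distances, which are bounded below by 0; for an edge the other endpoint guarantees that
  the infimum runs over a nonempty set.\<close>

lemma le_mult_nn_dist_iff:
  assumes "\<alpha> \<ge> 0" "V - {x} \<noteq> {}"
  shows "a \<le> \<alpha> * nn_dist d V x \<longleftrightarrow> (\<forall>z\<in>V - {x}. a \<le> \<alpha> * edist d x z)"
proof (cases "\<alpha> = 0")
  case False
  have "a \<le> \<alpha> * nn_dist d V x \<longleftrightarrow> a / \<alpha> \<le> nn_dist d V x"
    using False assms by (simp add: field_simps)
  also have "\<dots> \<longleftrightarrow> (\<forall>z\<in>V - {x}. a / \<alpha> \<le> edist d x z)"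
    unfolding nn_dist_def using assms
    by (intro le_cINF_iff) (auto intro: bdd_belowI[of _ 0])
  also have "\<dots> \<longleftrightarrow> (\<forall>z\<in>V - {x}. a \<le> \<alpha> * edist d x z)"
    using False assms by (simp add: field_simps)
  finally show ?thesis .
qed (use assms in auto)

lemma GN1_edges_iff:
  assumes "\<alpha> \<ge> 0"
  shows "(x, y) \<in> GN1_edges d \<alpha> V \<longleftrightarrow> x \<in> V \<and> y \<in> V \<and> x \<noteq> y \<and>
    ((\<forall>z\<in>V - {x}. edist d x y \<le> \<alpha> * edist d x z) \<or> (\<forall>z\<in>V - {y}. edist d x y \<le> \<alpha> * edist d y z))"
proof (cases "x \<in> V \<and> y \<in> V \<and> x \<noteq> y")
  case True
  then have "V - {x} \<noteq> {}" "V - {y} \<noteq> {}" by auto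
  then show ?thesis
    using True le_mult_nn_dist_iff[OF assms] by (simp add: GN1_edges_def)
qed (auto simp: GN1_edges_def)

text \<open>Each endpoint of an edge competes for being the nearest neighbour of the other, so
  either alternative gives |x - y| \<le> \<alpha> |x - y|, which is impossible at positive
  distance.\<close>

lemma GN1_edges_empty:
  assumes "V \<subseteq> space (leb d)" "0 \<le> \<alpha>" "\<alpha> < 1"
  shows "GN1_edges d \<alpha> V = {}"
proof -
  have False if "(x, y) \<in> GN1_edges d \<alpha> V" for x y
  proof -
    have xy: "x \<in> V" "y \<in> V" "x \<noteq> y"
      using that by (auto simp: GN1_edges_def)
    then have pos: "edist d x y > 0"
      using edist_eq_0_iff[of x d y] assms(1) edist_nonneg[of d x y] by (auto simp: less_le)
    have "edist d x y \<le> \<alpha> * edist d x y \<or> edist d x y \<le> \<alpha> * edist d y x"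
      using that xy unfolding GN1_edges_iff[OF assms(2)] by auto
    then have "edist d x y \<le> \<alpha> * edist d x y"
      by (simp add: edist_commute)
    then show False using pos assms(3) by (simp add: mult_le_cancel_right1)
  qed
  then show ?thesis by auto
qed

lemma components_iff:
  "C \<in> components V E \<longleftrightarrow> (\<exists>x\<in>V. C = {y \<in> V. (x, y) \<in> E\<^sup>*})"
  by (auto simp: components_def quotient_def)

lemma ex_infinite_component_iff:
  "(\<exists>C\<in>components V E. infinite C) \<longleftrightarrow> (\<exists>x\<in>V. infinite {y \<in> V. (x, y) \<in> E\<^sup>*})"
  unfolding Bex_def components_iff by auto

lemma percolation_event_empty:
  assumes "homogeneous_poisson_process d \<rho> M X" "0 \<le> \<alpha>" "\<alpha> < 1"
  shows "percolation_event d \<alpha> M X = {}"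
proof -
  have "finite {y \<in> X \<omega>. (x, y) \<in> (GN1_edges d \<alpha> (X \<omega>))\<^sup>*}" if "\<omega> \<in> space M" for \<omega> x
  proof -
    have "GN1_edges d \<alpha> (X \<omega>) = {}"
      using that assms by (intro GN1_edges_empty) (auto simp: homogeneous_poisson_process_def)
    then show ?thesis by (auto intro: finite_subset[of _ "{x}"])
  qed
  then show ?thesis by (auto simp: percolation_event_def ex_infinite_component_iff)
qed

lemma critical_value_ge_1:
  assumes "homogeneous_poisson_process d \<rho> M X"
  shows "critical_value d M X \<ge> 1"
  unfolding critical_value_def
proof (rule Inf_greatest)
  fix a assume "a \<in> ereal ` {\<alpha>. 0 \<le> \<alpha> \<and> measure M (percolation_event d \<alpha> M X) > 0}"
  then obtain \<alpha> where "a = ereal \<alpha>" "0 \<le> \<alpha>" "measure M (percolation_event d \<alpha> M X) > 0"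
    by auto
  then show "1 \<le> a"
    using percolation_event_empty[OF assms, of \<alpha>] by (cases "\<alpha> < 1") (auto simp: one_ereal_def)
qed

lemma critical_value_le:
  assumes "0 \<le> \<alpha>" "measure M (percolation_event d \<alpha> M X) > 0"
  shows "critical_value d M X \<le> ereal \<alpha>"
  unfolding critical_value_def using assms by (intro Inf_lower) auto

lemma homogeneous_poisson_processD:
  assumes "homogeneous_poisson_process d \<rho> M X"
  shows "\<rho> > 0" "prob_space M" "\<And>\<omega>. \<omega> \<in> space M \<Longrightarrow> locally_finite d (X \<omega>)"
    "\<And>B. B \<in> bounded_borel d \<Longrightarrow> (\<lambda>\<omega>. card (X \<omega> \<inter> B)) \<in> measurable M (count_space UNIV)"
    "\<And>B k. B \<in> bounded_borel d \<Longrightarrow> measure M {\<omega> \<in> space M. card (X \<omega> \<inter> B) = k} =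
               (\<rho> * measure (leb d) B) ^ k / fact k * exp (- (\<rho> * measure (leb d) B))"
    "\<And>n B. (\<And>i. i < n \<Longrightarrow> B i \<in> bounded_borel d) \<Longrightarrow> disjoint_family_on B {..<n} \<Longrightarrow>
        prob_space.indep_vars M (\<lambda>_. count_space UNIV) (\<lambda>i \<omega>. card (X \<omega> \<inter> B i)) {..<(n::nat)}"
  using assms unfolding homogeneous_poisson_process_def locally_finite_def by simp_all

subsection \<open>Measurability of the percolation event\<close>

text \<open>Only finitely many points are near \<open>x\<close>, so a fine enough mesh separates
  \<open>x\<close> from them. Cells are keyed by integer lists because these form a countable type;
  entries from \<open>d\<close> on are never looked at.\<close>

lemma locally_finite_isolated:
  assumes "locally_finite d V" "x \<in> V"
  obtains k :: nat and c :: "int list" where "V \<inter> grid_cell d (1 / Suc k) (\<lambda>i. c ! i) = {x}"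
proof -
  \<comment> \<open>\<open>sqrt d\<close> is the diagonal of a cell of side 1, the coarsest mesh in
    use, so \<open>B\<close> contains the cell of \<open>x\<close> for every mesh.\<close>
  define B where "B = {y \<in> space (leb d). edist d x y \<le> sqrt d}"
  have "bounded_set d B"
    unfolding bounded_set_def
  proof (intro exI ballI)
    fix y assume "y \<in> B"
    have "L2_set y {..<d} = L2_set (\<lambda>i. x i + - (x i - y i)) {..<d}" by simp
    also have "\<dots> \<le> L2_set x {..<d} + L2_set (\<lambda>i. - (x i - y i)) {..<d}"
      by (rule L2_set_triangle_ineq)
    also have "L2_set (\<lambda>i. - (x i - y i)) {..<d} = edist d x y"
      by (simp add: edist_def L2_set_def power2_commute)
    finally show "L2_set y {..<d} \<le> L2_set x {..<d} + sqrt d"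
      using \<open>y \<in> B\<close> by (simp add: B_def)
  qed
  then have fin: "finite (V \<inter> B)"
    using assms by (simp add: locally_finite_def)
  have V: "V \<subseteq> space (leb d)" using assms by (simp add: locally_finite_def)
  \<comment> \<open>Inserting 1 keeps the minimum defined when no other point is nearby.\<close>
  define m where "m = Min (insert 1 (edist d x ` (V \<inter> B - {x})))"
  have "m > 0"
    unfolding m_def using fin V assms(2) edist_eq_0_iff[of x d]
    by (subst Min_gr_iff) (auto simp: less_le subset_iff)
  obtain k :: nat where "sqrt d / m < k" using reals_Archimedean2 by blast
  then have k: "sqrt d / m < Suc k" by simp
  have k': "sqrt d / Suc k < m"
    using k \<open>m > 0\<close> by (simp add: field_simps)
  define c where "c = map (\<lambda>i. \<lfloor>x i / (1 / Suc k)\<rfloor>) [0..<d]"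
  have "V \<inter> grid_cell d (1 / Suc k) (\<lambda>i. c ! i) = {x}"
  proof (intro equalityI subsetI)
    fix y assume y: "y \<in> V \<inter> grid_cell d (1 / Suc k) (\<lambda>i. c ! i)"
    have "\<bar>x i - y i\<bar> \<le> 1 / Suc k" if "i < d" for i
    proof -
      have "\<lfloor>y i * Suc k\<rfloor> = \<lfloor>x i * Suc k\<rfloor>"
        using y that by (simp add: grid_cell_def c_def)
      then have "\<bar>x i * Suc k - y i * Suc k\<bar> < 1" by linarith
      moreover have "x i * Suc k - y i * Suc k = (x i - y i) * Suc k"
        by (simp only: left_diff_distrib)
      ultimately have "\<bar>x i - y i\<bar> * Suc k < 1" by (simp add: abs_mult)
      then show ?thesis
        by (simp only: pos_le_divide_eq of_nat_0_less_iff zero_less_Suc less_imp_le)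
    qed
    then have "L2_set (\<lambda>i. \<bar>x i - y i\<bar>) {..<d} \<le> L2_set (\<lambda>i. 1 / Suc k) {..<d}"
      by (intro L2_set_mono) auto
    then have "edist d x y \<le> L2_set (\<lambda>i. 1 / Suc k) {..<d}"
      by (simp add: edist_def L2_set_def)
    also have "\<dots> = sqrt d / Suc k"
      by (subst L2_set_constant) (simp_all add: L2_set_def real_sqrt_mult)
    finally have le: "edist d x y \<le> sqrt d / Suc k" .
    also have "\<dots> \<le> sqrt d / 1" by (intro divide_left_mono) auto
    finally have "y \<in> B" using y V by (auto simp: B_def)
    show "y \<in> {x}"
    proof (rule ccontr)
      assume "y \<notin> {x}"
      then have "m \<le> edist d x y"
        unfolding m_def using y \<open>y \<in> B\<close> fin by (intro Min_le) auto
      then show False using le k' by linarith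
    qed
  next
    fix y assume "y \<in> {x}"
    then show "y \<in> V \<inter> grid_cell d (1 / Suc k) (\<lambda>i. c ! i)"
      using assms V by (auto simp: grid_cell_def c_def)
  qed
  then show ?thesis by (rule that)
qed

text \<open>A countable parametrisation of the random points: quantification over points becomes
  quantification over keys, which preserves measurability. The value for a cell without exactly one
  point is a placeholder.\<close>

definition grid_point :: "nat \<Rightarrow> (nat \<Rightarrow> real) set \<Rightarrow> nat \<times> int list \<Rightarrow> nat \<Rightarrow> real" where
  "grid_point d V = (\<lambda>(k, c). if card (V \<inter> grid_cell d (1 / Suc k) (\<lambda>i. c ! i)) = 1
     then the_elem (V \<inter> grid_cell d (1 / Suc k) (\<lambda>i. c ! i)) else (\<lambda>_. 0))"

definition grid_isolated :: "nat \<Rightarrow> (nat \<Rightarrow> real) set \<Rightarrow> nat \<times> int list \<Rightarrow> bool" where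
  "grid_isolated d V = (\<lambda>(k, c). card (V \<inter> grid_cell d (1 / Suc k) (\<lambda>i. c ! i)) = 1)"

lemma grid_point_image:
  assumes "locally_finite d V"
  shows "V = grid_point d V ` {q. grid_isolated d V q}"
proof (intro equalityI subsetI)
  fix x assume "x \<in> V"
  from locally_finite_isolated[OF assms this] obtain k :: nat and c :: "int list"
    where kc: "V \<inter> grid_cell d (1 / Suc k) (\<lambda>i. c ! i) = {x}" .
  have "grid_isolated d V (k, c)" "grid_point d V (k, c) = x"
    unfolding grid_isolated_def grid_point_def case_prod_conv kc by simp_all
  then show "x \<in> grid_point d V ` {q. grid_isolated d V q}" by force
next
  fix x assume "x \<in> grid_point d V ` {q. grid_isolated d V q}"
  then obtain k c where "grid_isolated d V (k, c)" "x = grid_point d V (k, c)" by auto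
  moreover from this obtain y where "V \<inter> grid_cell d (1 / Suc k) (\<lambda>i. c ! i) = {y}"
    by (auto simp: grid_isolated_def card_1_singleton_iff simp del: of_nat_Suc)
  ultimately show "x \<in> V"
    by (auto simp: grid_isolated_def grid_point_def simp del: of_nat_Suc)
qed

text \<open>Bounded parts of \<open>V\<close> are finite, so infinity of a cluster can be tested by
  countably many distance conditions once points are replaced by keys.\<close>

lemma infinite_iff_unbounded:
  assumes "locally_finite d V" "C \<subseteq> V"
  shows "infinite C \<longleftrightarrow> (\<forall>N::nat. \<exists>y\<in>C. edist d y (\<lambda>_. 0) > N)"
proof
  assume "infinite C"
  show "\<forall>N::nat. \<exists>y\<in>C. edist d y (\<lambda>_. 0) > N"
  proof (rule ccontr)
    assume "\<not> ?thesis"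
    then obtain N :: nat where N: "\<And>y. y \<in> C \<Longrightarrow> edist d y (\<lambda>_. 0) \<le> N"
      by (auto simp: not_less)
    then have "bounded_set d C"
      by (auto simp: bounded_set_def edist_def)
    then have "finite (V \<inter> C)"
      using assms by (simp add: locally_finite_def)
    then show False
      using \<open>infinite C\<close> assms(2) by (simp add: Int_absorb1)
  qed
next
  assume *: "\<forall>N::nat. \<exists>y\<in>C. edist d y (\<lambda>_. 0) > N"
  show "infinite C"
  proof
    assume "finite C"
    obtain N :: nat where "(\<Sum>y\<in>C. edist d y (\<lambda>_. 0)) < N"
      using reals_Archimedean2 by blast
    moreover obtain y where "y \<in> C" "edist d y (\<lambda>_. 0) > N" using * by blast
    moreover have "edist d y (\<lambda>_. 0) \<le> (\<Sum>y\<in>C. edist d y (\<lambda>_. 0))"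
      using \<open>finite C\<close> \<open>y \<in> C\<close> by (intro member_le_sum) auto
    ultimately show False by linarith
  qed
qed

context
  fixes d \<rho> M and X :: "'w \<Rightarrow> (nat \<Rightarrow> real) set"
  assumes hpp: "homogeneous_poisson_process d \<rho> M X"
begin

lemma card_measurable:
  assumes "B \<in> bounded_borel d"
  shows "Measurable.pred M (\<lambda>\<omega>. card (X \<omega> \<inter> B) = k)"
  using homogeneous_poisson_processD(4)[OF hpp assms] by measurable

lemma grid_isolated_measurable [measurable]: "Measurable.pred M (\<lambda>\<omega>. grid_isolated d (X \<omega>) q)"
  unfolding grid_isolated_def by (cases q) (simp add: card_measurable grid_cell_bounded_borel del: of_nat_Suc)

text \<open>Only counts are known to be measurable. If the cell holds exactly one point, that point
  has coordinate \<open>i\<close> below \<open>a\<close> iff the part \<open>Q'\<close> of the cell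
  below \<open>a\<close> also has count 1.\<close>

lemma grid_point_measurable:
  assumes "i < d"
  shows "(\<lambda>\<omega>. grid_point d (X \<omega>) q i) \<in> borel_measurable M"
  unfolding borel_measurable_iff_less
proof
  fix a :: real
  obtain k c where q: "q = (k, c)" by (cases q)
  define Q where "Q = grid_cell d (1 / Suc k) (\<lambda>i. c ! i)"
  define Q' where "Q' = Q \<inter> {x \<in> space (leb d). x i < a}"
  have Q: "Q \<in> bounded_borel d"
    unfolding Q_def by (rule grid_cell_bounded_borel) simp
  have [measurable]: "(\<lambda>x. x i) \<in> borel_measurable (leb d)"
    using assms by (auto intro!: measurable_component_singleton)
  have "{x \<in> space (leb d). x i < a} \<in> sets (leb d)"
    by measurable
  then have Q': "Q' \<in> bounded_borel d"
    using Q by (auto simp: bounded_borel_def bounded_set_def Q'_def)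
  note [measurable] = card_measurable[OF Q, of 1] card_measurable[OF Q', of 1]
  have *: "grid_point d (X \<omega>) q i < a \<longleftrightarrow>
      (if card (X \<omega> \<inter> Q) = 1 then card (X \<omega> \<inter> Q') = 1 else 0 < a)" for \<omega>
  proof (cases "card (X \<omega> \<inter> Q) = 1")
    case True
    then obtain y where y: "X \<omega> \<inter> Q = {y}"
      by (auto simp: card_1_singleton_iff)
    then have "y \<in> space (leb d)" by (auto simp: Q_def grid_cell_def)
    moreover have "X \<omega> \<inter> Q' = {y} \<inter> {x \<in> space (leb d). x i < a}"
      using y by (auto simp: Q'_def)
    ultimately have "X \<omega> \<inter> Q' = (if y i < a then {y} else {})"
      by (simp add: Int_insert_left)
    then have "card (X \<omega> \<inter> Q') = 1 \<longleftrightarrow> y i < a" by simp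
    moreover have "grid_point d (X \<omega>) q = y"
      using y unfolding grid_point_def q case_prod_conv Q_def[symmetric] by simp
    ultimately show ?thesis using True by simp
  qed (unfold grid_point_def q case_prod_conv Q_def[symmetric], simp)
  show "{\<omega> \<in> space M. grid_point d (X \<omega>) q i < a} \<in> sets M" unfolding * by measurable
qed

lemma edist_grid_point_measurable [measurable]:
  "(\<lambda>\<omega>. edist d (grid_point d (X \<omega>) q) (grid_point d (X \<omega>) q')) \<in> borel_measurable M"
  "(\<lambda>\<omega>. edist d (grid_point d (X \<omega>) q) (\<lambda>_. 0)) \<in> borel_measurable M"
proof -
  have [measurable]: "(\<lambda>\<omega>. grid_point d (X \<omega>) q i) \<in> borel_measurable M" if "i \<in> {..<d}" for q i
    using that grid_point_measurable by simp
  show "(\<lambda>\<omega>. edist d (grid_point d (X \<omega>) q) (grid_point d (X \<omega>) q')) \<in> borel_measurable M"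
    "(\<lambda>\<omega>. edist d (grid_point d (X \<omega>) q) (\<lambda>_. 0)) \<in> borel_measurable M"
    unfolding edist_def L2_set_def by measurable
qed

text \<open>Equality of points is expressed by distance 0 and the competitors in the edge condition
  range over keys, so an edge is a countable combination of distance conditions. Longer walks follow
  by quantifying over the key of the last intermediate point.\<close>

lemma relpow_GN1_edges_measurable:
  assumes "\<alpha> \<ge> 0"
  shows "Measurable.pred M (\<lambda>\<omega>. grid_isolated d (X \<omega>) q \<and> grid_isolated d (X \<omega>) q' \<and>
    (grid_point d (X \<omega>) q, grid_point d (X \<omega>) q') \<in> GN1_edges d \<alpha> (X \<omega>) ^^ n)"
proof -
  define P where "P = (\<lambda>\<omega> q. grid_point d (X \<omega>) q)"
  define J where "J = (\<lambda>\<omega> q. grid_isolated d (X \<omega>) q)"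
  define E where "E = (\<lambda>\<omega>. GN1_edges d \<alpha> (X \<omega>))"
  have [measurable]: "Measurable.pred M (\<lambda>\<omega>. J \<omega> q)" 
    "(\<lambda>\<omega>. edist d (P \<omega> q) (P \<omega> q')) \<in> borel_measurable M" for q q'
    unfolding J_def P_def by measurable
  have X: "X \<omega> = P \<omega> ` {q. J \<omega> q}" if "\<omega> \<in> space M" for \<omega>
    unfolding P_def J_def using homogeneous_poisson_processD(3)[OF hpp that] by (rule grid_point_image)
  have P_space: "P \<omega> q \<in> space (leb d)" if "\<omega> \<in> space M" "J \<omega> q" for \<omega> q
    using X[OF that(1)] that homogeneous_poisson_processD(3)[OF hpp that(1)]
    by (auto simp: locally_finite_def)
  have eq_iff: "P \<omega> q = P \<omega> q' \<longleftrightarrow> edist d (P \<omega> q) (P \<omega> q') = 0"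
    if "\<omega> \<in> space M" "J \<omega> q" "J \<omega> q'" for \<omega> q q'
    using edist_eq_0_iff[OF P_space[OF that(1,2)] P_space[OF that(1,3)]] by simp
  have edge: "Measurable.pred M (\<lambda>\<omega>. J \<omega> q \<and> J \<omega> q' \<and> (P \<omega> q, P \<omega> q') \<in> E \<omega>)" for q q'
  proof -
    have "J \<omega> q \<and> J \<omega> q' \<and> (P \<omega> q, P \<omega> q') \<in> E \<omega> \<longleftrightarrow>
       J \<omega> q \<and> J \<omega> q' \<and> edist d (P \<omega> q) (P \<omega> q') \<noteq> 0 \<and>
       ((\<forall>r. J \<omega> r \<and> edist d (P \<omega> r) (P \<omega> q) \<noteq> 0 \<longrightarrow> edist d (P \<omega> q) (P \<omega> q') \<le> \<alpha> * edist d (P \<omega> q) (P \<omega> r)) \<or>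
        (\<forall>r. J \<omega> r \<and> edist d (P \<omega> r) (P \<omega> q') \<noteq> 0 \<longrightarrow> edist d (P \<omega> q) (P \<omega> q') \<le> \<alpha> * edist d (P \<omega> q') (P \<omega> r)))"
      if "\<omega> \<in> space M" for \<omega>
      unfolding E_def GN1_edges_iff[OF assms] using X[OF that]
      by (auto simp: eq_iff[OF that])
    then show ?thesis by (subst measurable_cong) measurable
  qed
  have "Measurable.pred M (\<lambda>\<omega>. J \<omega> q \<and> J \<omega> q' \<and> (P \<omega> q, P \<omega> q') \<in> E \<omega> ^^ n)" for q'
  proof (induction n arbitrary: q')
    case 0
    have "J \<omega> q \<and> J \<omega> q' \<and> (P \<omega> q, P \<omega> q') \<in> E \<omega> ^^ 0 \<longleftrightarrow>
        J \<omega> q \<and> J \<omega> q' \<and> edist d (P \<omega> q) (P \<omega> q') = 0" if "\<omega> \<in> space M" for \<omega>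
      using eq_iff[OF that, of q q'] by auto
    then show ?case by (subst measurable_cong) measurable
  next
    case (Suc n)
    define A where "A = (\<lambda>r \<omega>. J \<omega> q \<and> J \<omega> r \<and> (P \<omega> q, P \<omega> r) \<in> E \<omega> ^^ n)"
    define B where "B = (\<lambda>r \<omega>. J \<omega> r \<and> J \<omega> q' \<and> (P \<omega> r, P \<omega> q') \<in> E \<omega>)"
    have [measurable]: "Measurable.pred M (A r)" "Measurable.pred M (B r)" for r
      unfolding A_def B_def using Suc edge by simp_all
    have "J \<omega> q \<and> J \<omega> q' \<and> (P \<omega> q, P \<omega> q') \<in> E \<omega> ^^ Suc n \<longleftrightarrow>
        (\<exists>r. A r \<omega> \<and> B r \<omega>)"
      if "\<omega> \<in> space M" for \<omega>
    proof -
      have "y \<in> P \<omega> ` {q. J \<omega> q}" if "(y, z) \<in> E \<omega>" for y z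
        using that X[OF \<open>\<omega> \<in> space M\<close>] by (auto simp: E_def GN1_edges_def)
      then show ?thesis unfolding A_def B_def by (force elim: relpow_Suc_E intro: relpow_Suc_I)
    qed
    then show ?case by (subst measurable_cong) measurable
  qed
  then show ?thesis unfolding P_def J_def E_def .
qed

text \<open>\<open>measure\<close> is 0 outside the sigma-algebra, so an inclusion of events bounds
  the probability of percolation from below only together with this fact.\<close>

lemma percolation_event_measurable:
  assumes "\<alpha> \<ge> 0"
  shows "percolation_event d \<alpha> M X \<in> sets M"
proof -
  define A where "A = (\<lambda>q q' n \<omega>. grid_isolated d (X \<omega>) q \<and> grid_isolated d (X \<omega>) q' \<and>
      (grid_point d (X \<omega>) q, grid_point d (X \<omega>) q') \<in> GN1_edges d \<alpha> (X \<omega>) ^^ n)"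
  have [measurable]: "Measurable.pred M (A q q' n)" for q q' n
    unfolding A_def using relpow_GN1_edges_measurable[OF assms] by simp
  have "(\<exists>C\<in>components (X \<omega>) (GN1_edges d \<alpha> (X \<omega>)). infinite C) \<longleftrightarrow>
    (\<exists>q. grid_isolated d (X \<omega>) q \<and> (\<forall>N::nat. \<exists>q'. 
      (\<exists>n. A q q' n \<omega>) \<and>
      edist d (grid_point d (X \<omega>) q') (\<lambda>_. 0) > N))" (is "_ \<longleftrightarrow> ?R \<omega>") if "\<omega> \<in> space M" for \<omega>
  proof -
    have lf: "locally_finite d (X \<omega>)"
      using homogeneous_poisson_processD(3)[OF hpp that] .
    have bex: "(\<exists>x\<in>X \<omega>. Q x) \<longleftrightarrow> (\<exists>q. grid_isolated d (X \<omega>) q \<and> Q (grid_point d (X \<omega>) q))" for Q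
      by (subst grid_point_image[OF lf]) blast
    have "infinite {y \<in> X \<omega>. (x, y) \<in> (GN1_edges d \<alpha> (X \<omega>))\<^sup>*} \<longleftrightarrow>
        (\<forall>N::nat. \<exists>y\<in>X \<omega>. (x, y) \<in> (GN1_edges d \<alpha> (X \<omega>))\<^sup>* \<and> edist d y (\<lambda>_. 0) > N)" for x
      by (subst infinite_iff_unbounded[OF lf]) auto
    then show ?thesis
      unfolding ex_infinite_component_iff bex rtrancl_power A_def by auto
  qed
  then have "percolation_event d \<alpha> M X = {\<omega> \<in> space M. ?R \<omega>}"
    unfolding percolation_event_def by (intro Collect_cong conj_cong) auto
  also have "\<dots> \<in> sets M" by measurable
  finally show ?thesis .
qed

end

subsection \<open>The difference of two random walks in four dimensions\<close>

text \<open>Law after \<open>l\<close> steps of one coordinate of the difference of two independent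
  walks with uniform steps in {0, 1}: it moves by -1, 0, 1 with probabilities 1/4, 1/2, 1/4.\<close>

fun walk_kernel :: "nat \<Rightarrow> int \<Rightarrow> real" where
  "walk_kernel 0 x = (if x = 0 then 1 else 0)"
| "walk_kernel (Suc l) x = (walk_kernel l (x - 1) + 2 * walk_kernel l x + walk_kernel l (x + 1)) / 4"

lemma walk_kernel_nonneg: "walk_kernel l x \<ge> 0"
  by (induction l arbitrary: x) (auto intro!: add_nonneg_nonneg)

text \<open>The difference of two fair bits is distributed as the sum of two fair bits minus 1, so
  the kernel is the binomial law of \<open>2 * l\<close> bits shifted by \<open>l\<close>. The
  recursion is Pascal's rule applied twice, which needs an index of at least 2; smaller indices are
  separate cases.\<close>

lemma walk_kernel_eq_binomial:
  "walk_kernel l x = (if int l + x < 0 then 0 else ((2 * l) choose nat (int l + x)) / 4 ^ l)"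
proof (induction l arbitrary: x)
  case 0
  then show ?case by (auto simp: binomial_eq_0)
next
  case (Suc l)
  define k where "k = int l + 1 + x"
  have "k < 0 \<or> k = 0 \<or> k = 1 \<or> (\<exists>m. k = int m + 2)"
    by presburger
  then consider "k < 0" | "k = 0" | "k = 1" | m where "k = int m + 2" by blast
  then show ?case
  proof cases
    case 4
    then have *: "int l + (x - 1) = int m" "int l + x = int (Suc m)"
      "int l + (x + 1) = int (Suc (Suc m))" "int (Suc l) + x = int (Suc (Suc m))"
      by (auto simp: k_def)
    show ?thesis
      unfolding walk_kernel.simps Suc.IH * nat_int by (simp add: field_simps)
  next
    case 3
    then have *: "int l + (x - 1) = -1 + int 0" "int l + x = int 0"
      "int l + (x + 1) = int (Suc 0)" "int (Suc l) + x = int (Suc 0)"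
      by (auto simp: k_def)
    show ?thesis
      unfolding walk_kernel.simps Suc.IH * nat_int by (simp add: field_simps)
  next
    case 2
    then have *: "int l + (x - 1) = -2 + int 0" "int l + x = -1 + int 0"
      "int l + (x + 1) = int 0" "int (Suc l) + x = int 0"
      by (auto simp: k_def)
    show ?thesis
      unfolding walk_kernel.simps Suc.IH * nat_int by (simp add: field_simps)
  next
    case 1
    then have *: "int l + (x - 1) < 0" "int l + x < 0" "int l + (x + 1) < 0" "int (Suc l) + x < 0"
      by (auto simp: k_def)
    then show ?thesis
      unfolding walk_kernel.simps Suc.IH by simp
  qed
qed

text \<open>An elementary substitute for Stirling's formula: passing to \<open>Suc l\<close>
  multiplies the left side by 4 (2l+1) (2l+3) / (l+1)^2, which is at most 16 because (2l+1) (2l+3)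
  \<le> (2l+2)^2.\<close>

lemma central_binomial_square_le: "real ((2 * l) choose l) ^ 2 * (2 * l + 1) \<le> 16 ^ l"
proof (induction l)
  case (Suc l)
  have "Suc l * ((2 * Suc l) choose Suc l) = 2 * (2 * l + 1) * ((2 * l) choose l)"
  proof -
    have "Suc l * (Suc (Suc (2 * l)) choose Suc l) = Suc (Suc (2 * l)) * (Suc (2 * l) choose l)"
      by (rule Suc_times_binomial)
    moreover have "Suc l * (Suc (2 * l) choose l) = Suc l * (Suc (2 * l) choose Suc l)"
      by (subst binomial_symmetric) auto
    moreover have "Suc l * (Suc (2 * l) choose Suc l) = Suc (2 * l) * ((2 * l) choose l)"
      by (rule Suc_times_binomial)
    ultimately have "Suc l * (Suc l * (Suc (Suc (2 * l)) choose Suc l)) = Suc l * (2 * (2 * l + 1) * ((2 * l) choose l))"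
      by (simp add: algebra_simps)
    then show ?thesis
      by (simp only: mult_cancel1) simp
  qed
  then have eq: "(real l + 1) * real ((2 * Suc l) choose Suc l) = 2 * (2 * real l + 1) * real ((2 * l) choose l)"
    unfolding of_nat_eq_iff[where 'a = real, symmetric] of_nat_mult by (simp add: algebra_simps)
  have "(real l + 1)\<^sup>2 * (real ((2 * Suc l) choose Suc l) ^ 2 * (2 * Suc l + 1)) =
      ((real l + 1) * real ((2 * Suc l) choose Suc l)) ^ 2 * (2 * real l + 3)"
    by (simp add: power_mult_distrib)
  also have "\<dots> = (4 * (2 * real l + 1) * (2 * real l + 3)) * (real ((2 * l) choose l) ^ 2 * (2 * real l + 1))"
    unfolding eq by (simp add: power2_eq_square algebra_simps)
  also have "\<dots> \<le> (16 * (real l + 1)\<^sup>2) * 16 ^ l"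
  proof (rule mult_mono)
    show "4 * (2 * real l + 1) * (2 * real l + 3) \<le> 16 * (real l + 1)\<^sup>2"
      by (simp add: power2_eq_square algebra_simps)
    show "real ((2 * l) choose l) ^ 2 * (2 * real l + 1) \<le> 16 ^ l"
      using Suc by (simp add: algebra_simps)
  qed auto
  finally have "(real l + 1)\<^sup>2 * (real ((2 * Suc l) choose Suc l) ^ 2 * (2 * Suc l + 1)) \<le> (real l + 1)\<^sup>2 * 16 ^ Suc l"
    by (simp add: mult_ac)
  then show ?case
    by (subst (asm) mult_le_cancel_left_pos) auto
qed simp

text \<open>Here the choice of four dimensions enters: it turns the decay 1 / sqrt l of one
  coordinate into the order 1 / l^2, which is summable by an elementary argument.\<close>

lemma walk_kernel_power4_le: "walk_kernel l x ^ 4 \<le> 1 / (2 * real l + 1)\<^sup>2"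
proof -
  have "walk_kernel l x \<le> ((2 * l) choose l) / 4 ^ l"
    by (auto simp: walk_kernel_eq_binomial intro!: divide_right_mono binomial_maximum')
  then have "walk_kernel l x ^ 4 \<le> (((2 * l) choose l) / 4 ^ l) ^ 4"
    by (intro power_mono walk_kernel_nonneg)
  also have "\<dots> = (real ((2 * l) choose l) ^ 2 / 16 ^ l) ^ 2"
  proof -
    have "(4::real) ^ l * 4 ^ l = 16 ^ l"
      by (simp flip: power_mult_distrib)
    then have "(((2 * l) choose l) / 4 ^ l) ^ 2 = real ((2 * l) choose l) ^ 2 / 16 ^ l"
      by (simp add: power_divide power2_eq_square)
    moreover have "z ^ 4 = (z ^ 2) ^ 2" for z :: real by simp
    ultimately show ?thesis by presburger
  qed
  also have "\<dots> \<le> (1 / (2 * real l + 1)) ^ 2"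
    using central_binomial_square_le[of l] by (intro power_mono) (auto simp: field_simps)
  finally show ?thesis by (simp only: power_divide power_one)
qed

text \<open>The subtracted term is what the telescoping induction needs; the uniform bound 2 becomes
  the bound on the Green function.\<close>

lemma sum_inverse_odd_squares_le: "(\<Sum>l<n. 1 / (2 * real l + 1)\<^sup>2) \<le> 2 - 2 / (2 * real n + 1)"
proof (induction n)
  case (Suc n)
  have "1 / (2 * real n + 1)\<^sup>2 + 2 / (2 * real (Suc n) + 1) \<le> 2 / (2 * real n + 1)"
    by (simp add: divide_simps) (simp add: power2_eq_square algebra_simps)
  with Suc show ?case by simp
qed simp

definition walk_steps :: "(nat \<Rightarrow> int) set" where
  "walk_steps = ({1..<5} \<rightarrow>\<^sub>E {0, 1})"

definition near :: "nat \<Rightarrow> (nat \<Rightarrow> int) \<Rightarrow> bool" where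
  "near K v \<longleftrightarrow> (\<forall>j\<in>{1..<5}. \<bar>v j\<bar> \<le> int K)"

lemma finite_walk_steps [simp]: "finite walk_steps"
  by (simp add: walk_steps_def finite_PiE)

lemma card_walk_steps [simp]: "card walk_steps = 16"
  by (simp add: walk_steps_def card_PiE numeral_2_eq_2[symmetric])

lemma sum_swap_rotate:
  "(\<Sum>b\<in>B. \<Sum>c\<in>C. \<Sum>d\<in>D. G b c d) = (\<Sum>c\<in>C. \<Sum>d\<in>D. \<Sum>b\<in>B. G b c d)"
  by (subst sum.swap) (intro sum.cong refl sum.swap)

lemma sum_swap_pairs:
  fixes F :: "'a \<Rightarrow> 'b \<Rightarrow> 'c \<Rightarrow> 'd \<Rightarrow> 'e :: comm_monoid_add"
  shows
  "(\<Sum>a\<in>A. \<Sum>b\<in>B. \<Sum>c\<in>C. \<Sum>d\<in>D. F a b c d) = (\<Sum>c\<in>C. \<Sum>d\<in>D. \<Sum>a\<in>A. \<Sum>b\<in>B. F a b c d)"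
proof -
  have "(\<Sum>a\<in>A. \<Sum>b\<in>B. \<Sum>c\<in>C. \<Sum>d\<in>D. F a b c d) = (\<Sum>a\<in>A. \<Sum>c\<in>C. \<Sum>d\<in>D. \<Sum>b\<in>B. F a b c d)"
    by (intro sum.cong refl sum_swap_rotate)
  also have "\<dots> = (\<Sum>c\<in>C. \<Sum>d\<in>D. \<Sum>a\<in>A. \<Sum>b\<in>B. F a b c d)"
    by (rule sum_swap_rotate)
  finally show ?thesis .
qed

text \<open>Khas'minskii's lemma: adding a small multiple of a truncated Green function of the
  difference walk to the constant 1 yields a supersolution.\<close>

lemma walk_supersolution:
  fixes \<gamma> :: real
  assumes "\<gamma> \<ge> 0" "4 * \<gamma> * (2 * K + 1) ^ 4 \<le> 1"
  obtains f :: "nat \<Rightarrow> (nat \<Rightarrow> int) \<Rightarrow> real"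
  where "\<And>n v. 1 \<le> f n v" "\<And>n v. f n v \<le> 2"
    "\<And>n v v'. (\<And>j. j \<in> {1..<5} \<Longrightarrow> v j = v' j) \<Longrightarrow> f n v = f n v'"
    "\<And>n v. (\<Sum>s\<in>walk_steps. \<Sum>s'\<in>walk_steps.
        (1 + (if near K (v + s - s') then \<gamma> else 0)) * f n (v + s - s')) \<le> 256 * f (Suc n) v"
proof -
  define J where "J = {1..<5::nat}"
  define box where "box = (J \<rightarrow>\<^sub>E {- int K..int K})"
  \<comment> \<open>\<open>W\<close> is the kernel of the difference walk in four dimensions, and
    \<open>g a b\<close> is 1 plus 2 \<gamma> times the expected number of visits to the box at
    times from \<open>a\<close> to \<open>b - 1\<close>.\<close>
  define W where "W = (\<lambda>l v y. \<Prod>j\<in>J. walk_kernel l (v j - y j))"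
  define g where "g = (\<lambda>a b v. 1 + 2 * \<gamma> * (\<Sum>l\<in>{a..<b}. \<Sum>y\<in>box. W l v y))"
  have J: "finite J" "card J = 4" by (simp_all add: J_def)
  have box: "finite box" "real (card box) = (2 * K + 1) ^ 4"
    using J by (simp_all add: box_def finite_PiE card_PiE add.commute)
  have W_nonneg: "W l v y \<ge> 0" for l v y
    by (simp add: W_def prod_nonneg walk_kernel_nonneg)
  have W_le: "W l v y \<le> 1 / (2 * real l + 1)\<^sup>2" for l v y
  proof -
    define w where "w = Max ((\<lambda>j. walk_kernel l (v j - y j)) ` J)"
    have "w \<in> (\<lambda>j. walk_kernel l (v j - y j)) ` J"
      unfolding w_def using J by (intro Max_in) auto
    then obtain x where x: "w = walk_kernel l x" by auto
    have "W l v y \<le> (\<Prod>j\<in>J. w)"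
      unfolding W_def w_def using J by (intro prod_mono conjI walk_kernel_nonneg Max_ge) auto
    also have "\<dots> = walk_kernel l x ^ 4" using J by (simp add: x)
    also note walk_kernel_power4_le
    finally show ?thesis by simp
  qed
  have g_ge: "g a b v \<ge> 1" for a b v
    using assms(1) by (simp add: g_def sum_nonneg W_nonneg)
  \<comment> \<open>Each of the (2K+1)^4 points of the box is visited at most 2 times in
    expectation, so the excess over 1 is at most 4 \<gamma> (2K+1)^4; the second hypothesis is made
    for this.\<close>
  have g_le: "g a b v \<le> 2" for a b v
  proof -
    have "(\<Sum>l\<in>{a..<b}. \<Sum>y\<in>box. W l v y) \<le> (\<Sum>l<b. \<Sum>y\<in>box. W l v y)"
      by (intro sum_mono2 sum_nonneg W_nonneg) auto
    also have "\<dots> \<le> (\<Sum>l<b. real (card box) * (1 / (2 * real l + 1)\<^sup>2))"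
      by (intro sum_mono sum_bounded_above W_le)
    also have "\<dots> = real (card box) * (\<Sum>l<b. 1 / (2 * real l + 1)\<^sup>2)"
      by (simp add: sum_distrib_left)
    also have "\<dots> \<le> real (card box) * 2"
      using sum_inverse_odd_squares_le[of b] by (intro mult_left_mono) (auto intro: order_trans)
    finally have "2 * \<gamma> * (\<Sum>l\<in>{a..<b}. \<Sum>y\<in>box. W l v y) \<le> 2 * \<gamma> * (real (card box) * 2)"
      using assms(1) by (intro mult_left_mono) auto
    also have "\<dots> = 4 * \<gamma> * (2 * real K + 1) ^ 4"
      using box by (simp add: add.commute)
    finally show ?thesis using assms(2) unfolding g_def by linarith
  qed
  \<comment> \<open>The sum over the 16 * 16 pairs of steps factorises over the four coordinates,
    each giving 4 times one step of the kernel.\<close>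
  have W_step: "(\<Sum>s\<in>walk_steps. \<Sum>s'\<in>walk_steps. W l (v + s - s') y) = 256 * W (Suc l) v y" for l v y
  proof -
    have "(\<Sum>s\<in>walk_steps. \<Sum>s'\<in>walk_steps. W l (v + s - s') y) =
        (\<Sum>s\<in>J \<rightarrow>\<^sub>E {0, 1}. \<Sum>s'\<in>J \<rightarrow>\<^sub>E {0, 1}. \<Prod>j\<in>J. walk_kernel l (v j + s j - s' j - y j))"
      by (simp add: walk_steps_def W_def J_def)
    also have "\<dots> = (\<Sum>s\<in>J \<rightarrow>\<^sub>E {0, 1}. \<Prod>j\<in>J. \<Sum>t'\<in>{0, 1}. walk_kernel l (v j + s j - t' - y j))"
      using J by (intro sum.cong refl prod_sum_PiE[symmetric]) auto
    also have "\<dots> = (\<Prod>j\<in>J. \<Sum>t\<in>{0, 1}. \<Sum>t'\<in>{0, 1}. walk_kernel l (v j + t - t' - y j))"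
      using J by (intro prod_sum_PiE[symmetric]) auto
    also have "\<dots> = (\<Prod>j\<in>J. 4 * walk_kernel (Suc l) (v j - y j))"
      by (intro prod.cong refl) (simp add: algebra_simps)
    also have "\<dots> = 256 * W (Suc l) v y"
      using J by (simp add: W_def prod.distrib del: walk_kernel.simps)
    finally show ?thesis .
  qed
  have g_step: "(\<Sum>s\<in>walk_steps. \<Sum>s'\<in>walk_steps. g a b (v + s - s')) = 256 * g (Suc a) (Suc b) v" for a b v
  proof -
    have "(\<Sum>s\<in>walk_steps. \<Sum>s'\<in>walk_steps. \<Sum>l\<in>{a..<b}. \<Sum>y\<in>box. W l (v + s - s') y) =
        (\<Sum>l\<in>{a..<b}. \<Sum>y\<in>box. \<Sum>s\<in>walk_steps. \<Sum>s'\<in>walk_steps. W l (v + s - s') y)"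
      by (rule sum_swap_pairs)
    also have "\<dots> = 256 * (\<Sum>l\<in>{a..<b}. \<Sum>y\<in>box. W (Suc l) v y)"
      by (simp add: W_step sum_distrib_left)
    also have "(\<Sum>l\<in>{a..<b}. \<Sum>y\<in>box. W (Suc l) v y) = (\<Sum>l\<in>{Suc a..<Suc b}. \<Sum>y\<in>box. W l v y)"
      by (simp only: sum.shift_bounds_Suc_ivl)
    finally have *: "(\<Sum>s\<in>walk_steps. \<Sum>s'\<in>walk_steps. \<Sum>l\<in>{a..<b}. \<Sum>y\<in>box. W l (v + s - s') y) =
      256 * (\<Sum>l\<in>{Suc a..<Suc b}. \<Sum>y\<in>box. W l v y)" .
    have "(\<Sum>s\<in>walk_steps. \<Sum>s'\<in>walk_steps. g a b (v + s - s')) = 256 + 2 * \<gamma> *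
      (\<Sum>s\<in>walk_steps. \<Sum>s'\<in>walk_steps. \<Sum>l\<in>{a..<b}. \<Sum>y\<in>box. W l (v + s - s') y)"
      by (simp add: g_def sum.distrib flip: sum_distrib_left)
    then show ?thesis
      unfolding * g_def by (simp only: distrib_left)
  qed
  have W_0: "(\<Sum>y\<in>box. W 0 v y) = (if near K v then 1 else 0)" for v
  proof -
    have "(\<Sum>y\<in>box. W 0 v y) = (\<Prod>j\<in>J. \<Sum>t\<in>{- int K..int K}. walk_kernel 0 (v j - t))"
      unfolding W_def box_def using J by (intro prod_sum_PiE[symmetric]) auto
    also have "\<dots> = (\<Prod>j\<in>J. if \<bar>v j\<bar> \<le> int K then 1 else 0)"
      by (intro prod.cong refl) (auto simp: sum.delta)
    also have "\<dots> = (if near K v then 1 else 0)"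
      using J by (auto simp: near_def J_def)
    finally show ?thesis .
  qed
  \<comment> \<open>\<open>f\<close> omits time 0. The omitted term is 2 \<gamma> times the
    indicator of \<open>near\<close>, and since f \<le> 2 it pays for the extra \<gamma> f on the
    left; one step of the walk then turns \<open>g 0 (Suc n)\<close> into
    \<open>f (Suc n)\<close>.\<close>
  define f where "f = (\<lambda>n. g 1 (Suc n))"
  have "(1 + (if near K v then \<gamma> else 0)) * f n v \<le> g 0 (Suc n) v" for n v
  proof -
    have "g 0 (Suc n) v = f n v + 2 * \<gamma> * (if near K v then 1 else 0)"
      unfolding f_def g_def by (subst sum.atLeast_Suc_lessThan) (auto simp: W_0 algebra_simps)
    moreover have "\<gamma> * f n v \<le> \<gamma> * 2"
      unfolding f_def using assms(1) g_le by (intro mult_left_mono) auto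
    ultimately show ?thesis by (auto simp: algebra_simps)
  qed
  then have "(\<Sum>s\<in>walk_steps. \<Sum>s'\<in>walk_steps.
      (1 + (if near K (v + s - s') then \<gamma> else 0)) * f n (v + s - s')) \<le>
      (\<Sum>s\<in>walk_steps. \<Sum>s'\<in>walk_steps. g 0 (Suc n) (v + s - s'))" for n v
    by (intro sum_mono)
  then have "(\<Sum>s\<in>walk_steps. \<Sum>s'\<in>walk_steps.
      (1 + (if near K (v + s - s') then \<gamma> else 0)) * f n (v + s - s')) \<le> 256 * f (Suc n) v" for n v
    unfolding g_step f_def One_nat_def .
  moreover have "f n v = f n v'" if "\<And>j. j \<in> {1..<5} \<Longrightarrow> v j = v' j" for n v v'
  proof -
    have "W l v y = W l v' y" for l y
      unfolding W_def J_def using that by (intro prod.cong) auto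
    then show ?thesis by (simp add: f_def g_def)
  qed
  ultimately show ?thesis
    using that[of f] g_ge g_le unfolding f_def by blast
qed

subsection \<open>Counting lattice points in balls\<close>

definition lattice_ball :: "nat set \<Rightarrow> real \<Rightarrow> (nat \<Rightarrow> int) set" where
  "lattice_ball I t = {c. (\<forall>i. i \<notin> I \<longrightarrow> c i = 0) \<and> L2_set (\<lambda>i. real_of_int (c i)) I \<le> t}"

lemma lattice_ball_zero: "c \<in> lattice_ball I t \<Longrightarrow> i \<notin> I \<Longrightarrow> c i = 0"
  by (simp add: lattice_ball_def)

lemma lattice_ball_coord:
  assumes "finite I" "c \<in> lattice_ball I t" "i \<in> I"
  shows "\<bar>c i\<bar> \<le> \<lfloor>t\<rfloor>"
proof -
  have "\<bar>real_of_int (c i)\<bar> \<le> L2_set (\<lambda>i. \<bar>real_of_int (c i)\<bar>) I"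
    using assms by (intro member_le_L2_set) auto
  also have "\<dots> \<le> t"
    using assms by (simp add: lattice_ball_def L2_set_def)
  finally show ?thesis by (simp add: le_floor_iff)
qed

lemma finite_lattice_ball [simp]:
  assumes "finite I"
  shows "finite (lattice_ball I t)"
proof (rule finite_subset)
  show "lattice_ball I t \<subseteq> {c. \<forall>i. (i \<in> I \<longrightarrow> c i \<in> {- \<lfloor>t\<rfloor>..\<lfloor>t\<rfloor>}) \<and> (i \<notin> I \<longrightarrow> c i = 0)}"
  proof (intro subsetI CollectI allI conjI impI)
    fix c i assume c: "c \<in> lattice_ball I t"
    show "c i = 0" if "i \<notin> I" using c that by (simp add: lattice_ball_def)
    show "c i \<in> {- \<lfloor>t\<rfloor>..\<lfloor>t\<rfloor>}" if "i \<in> I"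
      using lattice_ball_coord[OF assms c that] by (simp add: abs_le_iff minus_le_iff)
  qed
qed (intro finite_set_of_finite_funs assms finite_atLeastAtMost_int)

lemma zero_in_lattice_ball [simp]: "t \<ge> 0 \<Longrightarrow> (\<lambda>_. 0) \<in> lattice_ball I t"
  by (simp add: lattice_ball_def L2_set_0')

lemma L2_set_le_sqrt_card:
  assumes "\<And>i. i \<in> I \<Longrightarrow> \<bar>f i\<bar> \<le> 1"
  shows "L2_set f I \<le> sqrt (card I)"
proof -
  have "(\<Sum>i\<in>I. (f i)\<^sup>2) \<le> (\<Sum>i\<in>I. 1)"
    using assms by (intro sum_mono) (simp add: abs_square_le_1)
  then show ?thesis by (simp add: L2_set_def)
qed

lemma L2_set_le_add_dist: "L2_set f I \<le> L2_set g I + L2_set (\<lambda>i. f i - g i) I"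
  using L2_set_triangle_ineq[of g "\<lambda>i. f i - g i" I] by simp

text \<open>The half-open unit cubes with lower corners in the lattice ball are disjoint and have
  diameter at most sqrt (card I), so their union lies between the Euclidean balls of radii t - sqrt
  (card I) and t + sqrt (card I).\<close>

lemma lattice_ball_volume:
  assumes I: "finite I" and c: "card (lattice_ball I t) = n"
  shows "t + sqrt (card I) > 0 \<Longrightarrow> n \<le> unit_ball_vol (card I) * (t + sqrt (card I)) ^ card I"
    and "t > sqrt (card I) \<Longrightarrow> unit_ball_vol (card I) * (t - sqrt (card I)) ^ card I \<le> n"
proof -
  interpret product_sigma_finite "\<lambda>_::nat. lborel :: real measure" ..
  define M where "M = Pi\<^sub>M I (\<lambda>_. lborel :: real measure)"
  define Q where "Q = (\<lambda>c. Pi\<^sub>E I (\<lambda>i. {real_of_int (c i)..<real_of_int (c i + 1)}))"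
  define B where "B = (\<lambda>r. {f. sqrt (\<Sum>i\<in>I. (f i)\<^sup>2) \<le> r} \<inter> space M)"
  have Q_sets: "Q c \<in> sets M" for c
    unfolding Q_def M_def using I by (intro sets_PiM_I_finite) auto
  have Q_iff: "x \<in> Q c \<longleftrightarrow> x \<in> space M \<and> (\<forall>i\<in>I. \<lfloor>x i\<rfloor> = c i)" for x c
    by (auto simp: Q_def M_def space_PiM PiE_iff floor_eq_iff)
  have Q_measure: "emeasure M (Q c) = 1" for c
    unfolding Q_def M_def using I by (subst emeasure_PiM) auto
  have disj: "disjoint_family_on Q (lattice_ball I t)"
    unfolding disjoint_family_on_def
  proof (intro ballI impI)
    fix c c' assume *: "c \<in> lattice_ball I t" "c' \<in> lattice_ball I t" "c \<noteq> c'"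
    show "Q c \<inter> Q c' = {}"
    proof (rule ccontr)
      assume "Q c \<inter> Q c' \<noteq> {}"
      then have "\<forall>i\<in>I. c i = c' i" by (fastforce simp: Q_iff)
      then have "c = c'" using * by (fastforce simp: lattice_ball_def)
      then show False using * by simp
    qed
  qed
  have union: "emeasure M (\<Union>c\<in>lattice_ball I t. Q c) = ennreal n"
    using I Q_sets disj c by (subst sum_emeasure[symmetric]) (auto simp: Q_measure ennreal_of_nat_eq_real_of_nat)
  have union_sets: "(\<Union>c\<in>lattice_ball I t. Q c) \<in> sets M"
    using I Q_sets by (intro sets.finite_UN) auto
  have B_measure: "emeasure M (B r) = ennreal (unit_ball_vol (card I) * r ^ card I)" if "r > 0" for r
    unfolding M_def B_def using emeasure_cball_aux[OF I that] .
  have B_sets: "B r \<in> sets M" for r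
  proof -
    have "(\<lambda>f. sqrt (\<Sum>i\<in>I. (f i)\<^sup>2)) \<in> borel_measurable M"
      unfolding M_def by measurable
    then show ?thesis unfolding B_def by (simp add: Int_def conj_commute)
  qed
  have diff: "L2_set (\<lambda>i. x i - c i) I \<le> sqrt (card I)" "L2_set (\<lambda>i. c i - x i) I \<le> sqrt (card I)"
    if "\<forall>i\<in>I. \<lfloor>x i\<rfloor> = c i" for x :: "nat \<Rightarrow> real" and c :: "nat \<Rightarrow> int"
    using that by (intro L2_set_le_sqrt_card; force simp: floor_eq_iff)+
  show "n \<le> unit_ball_vol (card I) * (t + sqrt (card I)) ^ card I" if "t + sqrt (card I) > 0"
  proof -
    have "(\<Union>c\<in>lattice_ball I t. Q c) \<subseteq> B (t + sqrt (card I))"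
    proof
      fix x assume "x \<in> (\<Union>c\<in>lattice_ball I t. Q c)"
      then obtain c where c: "c \<in> lattice_ball I t" "x \<in> space M" "\<forall>i\<in>I. \<lfloor>x i\<rfloor> = c i"
        by (auto simp: Q_iff)
      have "L2_set x I \<le> L2_set (\<lambda>i. real_of_int (c i)) I + L2_set (\<lambda>i. x i - real_of_int (c i)) I"
        by (rule L2_set_le_add_dist)
      also have "\<dots> \<le> t + sqrt (card I)"
        using diff[OF c(3)] c(1) by (intro add_mono) (auto simp: lattice_ball_def)
      finally show "x \<in> B (t + sqrt (card I))" using c by (simp add: B_def L2_set_def)
    qed
    then have "emeasure M (\<Union>c\<in>lattice_ball I t. Q c) \<le> emeasure M (B (t + sqrt (card I)))"
      by (intro emeasure_mono B_sets)
    then show ?thesis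
      unfolding union B_measure[OF that] using that by (subst (asm) ennreal_le_iff) auto
  qed
  show "unit_ball_vol (card I) * (t - sqrt (card I)) ^ card I \<le> n" if "t > sqrt (card I)"
  proof -
    have "B (t - sqrt (card I)) \<subseteq> (\<Union>c\<in>lattice_ball I t. Q c)"
    proof
      fix x assume x: "x \<in> B (t - sqrt (card I))"
      define c where "c = (\<lambda>i. if i \<in> I then \<lfloor>x i\<rfloor> else 0)"
      have c: "\<forall>i\<in>I. \<lfloor>x i\<rfloor> = c i" by (simp add: c_def)
      have "L2_set (\<lambda>i. real_of_int (c i)) I \<le> L2_set x I + L2_set (\<lambda>i. real_of_int (c i) - x i) I"
        by (rule L2_set_le_add_dist)
      also have "\<dots> \<le> (t - sqrt (card I)) + sqrt (card I)"
        using diff[OF c] x by (intro add_mono) (auto simp: B_def L2_set_def)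
      finally have "c \<in> lattice_ball I t" by (simp add: lattice_ball_def c_def)
      then show "x \<in> (\<Union>c\<in>lattice_ball I t. Q c)"
        using x c by (auto simp: Q_iff B_def)
    qed
    then have "emeasure M (B (t - sqrt (card I))) \<le> emeasure M (\<Union>c\<in>lattice_ball I t. Q c)"
      by (intro emeasure_mono union_sets)
    then show ?thesis
      unfolding union using that by (subst (asm) B_measure) (auto simp: ennreal_le_iff)
  qed
qed

lemma card_lattice_ball_scale:
  assumes "finite I" "I \<noteq> {}" "0 \<le> l" "0 < \<theta>" "\<theta> * (l + sqrt (card I)) \<le> t - sqrt (card I)"
  shows "\<theta> ^ card I * card (lattice_ball I l) \<le> card (lattice_ball I t)"
proof -
  have pos: "sqrt (card I) > 0" using assms by (simp add: card_gt_0_iff)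
  then have pos': "l + sqrt (card I) > 0" using assms(3) by linarith
  then have "\<theta> * (l + sqrt (card I)) > 0" using assms(4) by simp
  then have "t > sqrt (card I)" using assms(5) by linarith
  have "\<theta> ^ card I * card (lattice_ball I l) \<le> \<theta> ^ card I * (unit_ball_vol (card I) * (l + sqrt (card I)) ^ card I)"
    using assms lattice_ball_volume(1)[OF assms(1) refl pos'] by (intro mult_left_mono) auto
  also have "\<dots> = unit_ball_vol (card I) * (\<theta> * (l + sqrt (card I))) ^ card I"
    by (simp add: power_mult_distrib)
  also have "\<dots> \<le> unit_ball_vol (card I) * (t - sqrt (card I)) ^ card I"
    using assms pos' by (intro mult_left_mono power_mono) auto
  also have "\<dots> \<le> card (lattice_ball I t)"
    using lattice_ball_volume(2)[OF assms(1) refl \<open>t > sqrt (card I)\<close>] .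
  finally show ?thesis .
qed

text \<open>Void balls live in all \<open>d\<close> coordinates, whereas steps are free only from
  coordinate 5 on. Forgetting the first \<open>m\<close> coordinates has fibres of at most (2l+1)^m
  points, a factor that stays polynomial in \<open>d\<close>.\<close>

lemma card_lattice_ball_project:
  assumes "m \<le> d"
  shows "card (lattice_ball {..<d} (real l)) \<le> (2 * l + 1) ^ m * card (lattice_ball {m..<d} (real l))"
proof -
  define P where "P = {..<m} \<rightarrow>\<^sub>E {- int l..int l}"
  define f where "f = (\<lambda>c::nat \<Rightarrow> int. (restrict c {..<m}, \<lambda>i. if i < m then 0 else c i))"
  have "inj f"
  proof (rule injI, rule ext)
    fix c c' i assume "f c = f c'"
    then have "fst (f c) i = fst (f c') i" "snd (f c) i = snd (f c') i" by simp_all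
    then show "c i = c' i" by (cases "i < m") (simp_all add: f_def)
  qed
  then have "card (lattice_ball {..<d} (real l)) = card (f ` lattice_ball {..<d} (real l))"
    by (metis card_image inj_on_subset subset_UNIV)
  also have "\<dots> \<le> card (P \<times> lattice_ball {m..<d} (real l))"
  proof (rule card_mono)
    show "finite (P \<times> lattice_ball {m..<d} (real l))" by (simp add: P_def finite_PiE)
    show "f ` lattice_ball {..<d} (real l) \<subseteq> P \<times> lattice_ball {m..<d} (real l)"
    proof (rule image_subsetI)
      fix c assume c: "c \<in> lattice_ball {..<d} (real l)"
      have "restrict c {..<m} \<in> P"
      proof -
        have "c i \<in> {- int l..int l}" if "i < m" for i
          using lattice_ball_coord[OF _ c, of i] assms that by (simp add: abs_le_iff minus_le_iff)
        then show ?thesis by (auto simp: P_def)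
      qed
      moreover have "L2_set (\<lambda>i. real_of_int (if i < m then 0 else c i)) {m..<d} \<le> L2_set (\<lambda>i. real_of_int (c i)) {..<d}"
      proof -
        have "(\<Sum>i\<in>{m..<d}. (real_of_int (if i < m then 0 else c i))\<^sup>2) = (\<Sum>i\<in>{m..<d}. (real_of_int (c i))\<^sup>2)"
          by (intro sum.cong) auto
        also have "\<dots> \<le> (\<Sum>i<d. (real_of_int (c i))\<^sup>2)"
          by (intro sum_mono2) auto
        finally show ?thesis by (simp add: L2_set_def)
      qed
      ultimately show "f c \<in> P \<times> lattice_ball {m..<d} (real l)"
        using c by (auto simp: f_def lattice_ball_def)
    qed
  qed
  also have "\<dots> = (2 * l + 1) ^ m * card (lattice_ball {m..<d} (real l))"
    by (simp add: card_cartesian_product P_def card_PiE add.commute nat_add_distrib nat_mult_distrib)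
  finally show ?thesis .
qed

subsection \<open>A tree of lattice paths\<close>

definition path_step :: "(nat \<Rightarrow> int) \<Rightarrow> (nat \<Rightarrow> int) \<Rightarrow> nat \<Rightarrow> int" where
  "path_step s w = (\<lambda>i. if i = 0 then 1 else if i < 5 then s i else w i)"

text \<open>Bounds \<open>P(h and h' good) / (P(h good) P(h' good))\<close>: a cube common to both paths costs
  one factor \<open>a = 1 / P(cube occupied)\<close>, and a void region common to both is paid for by factors \<open>e\<close>
  at those times when the walks are near.\<close>

definition overlap_weight :: "real \<Rightarrow> real \<Rightarrow> nat \<Rightarrow> (nat \<Rightarrow> int) list \<Rightarrow> (nat \<Rightarrow> int) list \<Rightarrow> real" where
  "overlap_weight a e K h h' =
    (\<Prod>(c, c')\<leftarrow>zip h h'. (if c = c' then a else 1) * (if near K (c - c') then e else 1))"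

lemma path_step_inject:
  assumes "path_step s w = path_step s' w'" "s \<in> walk_steps" "s' \<in> walk_steps"
    "w \<in> lattice_ball {5..<d} t" "w' \<in> lattice_ball {5..<d} t"
  shows "s = s'" "w = w'"
proof -
  have eq: "path_step s w i = path_step s' w' i" for i using assms(1) by simp
  show "s = s'"
  proof (rule PiE_ext)
    show "s \<in> {1..<5} \<rightarrow>\<^sub>E {0, 1}" "s' \<in> {1..<5} \<rightarrow>\<^sub>E {0, 1}"
      using assms by (simp_all add: walk_steps_def)
    fix i :: nat assume "i \<in> {1..<5}"
    then show "s i = s' i" using eq[of i] by (simp add: path_step_def)
  qed
  show "w = w'"
  proof
    fix i
    show "w i = w' i"
    proof (cases "i < 5")
      case True
      then have "i \<notin> {5..<d}" by simp
      then show ?thesis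
        using lattice_ball_zero[OF assms(4)] lattice_ball_zero[OF assms(5)] by simp
    next
      case False
      then show ?thesis using eq[of i] by (simp add: path_step_def)
    qed
  qed
qed

locale path_tree =
  fixes d l b :: nat and t :: real
  assumes room: "b + l * card (lattice_ball {..<d} (real l)) \<le> card (lattice_ball {5..<d} t)"
    and b_pos: "b > 0" and d_ge: "5 \<le> d"
begin

abbreviation D :: "(nat \<Rightarrow> int) set" where "D \<equiv> lattice_ball {..<d} (real l)"

definition allowed :: "(nat \<Rightarrow> int) list \<Rightarrow> (nat \<Rightarrow> int) \<Rightarrow> (nat \<Rightarrow> int) set" where
  "allowed h s = {w \<in> lattice_ball {5..<d} t. \<forall>c\<in>set h. hd h + path_step s w - c \<notin> D}"

definition extensions :: "(nat \<Rightarrow> int) list \<Rightarrow> (nat \<Rightarrow> int) \<Rightarrow> (nat \<Rightarrow> int) set" where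
  "extensions h s = (SOME A. A \<subseteq> allowed h s \<and> card A = b)"

text \<open>The most recent cube of a path is the head of the list. Trimming the allowed steps to exactly \<open>b\<close>
  makes the tree regular, so that the uniform measure on paths is the right weight.\<close>

fun paths :: "nat \<Rightarrow> (nat \<Rightarrow> int) list set" where
  "paths 0 = {[\<lambda>_. 0]}"
| "paths (Suc n) = (\<lambda>(h, s, w). (hd h + path_step s w) # h) `
     (SIGMA h:paths n. SIGMA s:walk_steps. extensions h s)"

text \<open>The cube at index \<open>i\<close> is \<open>i + 1\<close> time units older than the
  next one, so only indices below \<open>l\<close> can forbid a step. A fixed cube forbids at most
  \<open>card D\<close> steps, since the displacement from it determines \<open>w\<close>. By
  \<open>room\<close> at least \<open>b\<close> steps survive.\<close>

lemma extensions_allowed: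
  assumes "length h = Suc n" "\<And>i. i \<le> n \<Longrightarrow> (h ! i) 0 = int (n - i)"
  shows "extensions h s \<subseteq> allowed h s" "card (extensions h s) = b"
proof -
  define B where "B = lattice_ball {5..<d} t"
  define F where "F = (\<lambda>i. {w \<in> B. hd h + path_step s w - h ! i \<in> D})"
  have fin: "finite B" by (simp add: B_def)
  have card_F: "card (F i) \<le> card D" for i
  proof (rule card_inj_on_le)
    show "inj_on (\<lambda>w. hd h + path_step s w - h ! i) (F i)"
    proof (rule inj_onI)
      fix w w' assume ww': "w \<in> F i" "w' \<in> F i"
        and "hd h + path_step s w - h ! i = hd h + path_step s w' - h ! i"
      then have eq: "path_step s w = path_step s w'" by simp
      show "w = w'"
      proof
        fix j
        show "w j = w' j"
        proof (cases "j < 5")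
          case True
          then have "j \<notin> {5..<d}" by simp
          then show ?thesis
            using ww' lattice_ball_zero[of w "{5..<d}" t j] lattice_ball_zero[of w' "{5..<d}" t j] by (simp add: F_def B_def)
        next
          case False
          then show ?thesis using fun_cong[OF eq, of j] by (simp add: path_step_def)
        qed
      qed
    qed
  qed (auto simp: F_def)
  have "B - allowed h s \<subseteq> (\<Union>i<l. F i)"
  proof
    fix w assume w: "w \<in> B - allowed h s"
    then obtain i where i: "i \<le> n" "hd h + path_step s w - h ! i \<in> D"
      using assms(1) by (auto simp: allowed_def B_def in_set_conv_nth less_Suc_eq_le)
    have "\<bar>(hd h + path_step s w - h ! i) 0\<bar> \<le> \<lfloor>real l\<rfloor>"
      by (rule lattice_ball_coord[OF _ i(2)]) (use d_ge in simp_all)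
    moreover have "hd h 0 = int n"
      using assms(1) assms(2)[of 0] by (cases h) auto
    ultimately have "i < l"
      using assms(2)[OF i(1)] i(1) by (simp add: path_step_def)
    then show "w \<in> (\<Union>i<l. F i)" using w i by (auto simp: F_def)
  qed
  then have "card (B - allowed h s) \<le> card (\<Union>i<l. F i)"
    using fin by (intro card_mono) (auto simp: F_def)
  also have "\<dots> \<le> (\<Sum>i<l. card (F i))"
    by (rule card_UN_le) simp
  also have "\<dots> \<le> l * card D"
    using sum_bounded_above[of "{..<l}" "\<lambda>i. card (F i)" "card D"] card_F by simp
  finally have "card (B - allowed h s) \<le> l * card D" .
  moreover have "card (B - allowed h s) = card B - card (allowed h s)"
    using fin by (intro card_Diff_subset finite_subset[OF _ fin]) (auto simp: allowed_def B_def)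
  ultimately have "b \<le> card (allowed h s)"
    using room by (simp add: B_def)
  then obtain A where "A \<subseteq> allowed h s" "card A = b"
    by (meson obtain_subset_with_card_n)
  then have "extensions h s \<subseteq> allowed h s \<and> card (extensions h s) = b"
    unfolding extensions_def by (intro someI[of "\<lambda>A. A \<subseteq> allowed h s \<and> card A = b"]) auto
  then show "extensions h s \<subseteq> allowed h s" "card (extensions h s) = b" by auto
qed

lemma paths_time:
  assumes "h \<in> paths n"
  shows "length h = Suc n" "\<And>i. i \<le> n \<Longrightarrow> (h ! i) 0 = int (n - i)"
proof -
  have "length h = Suc n \<and> (\<forall>i\<le>n. (h ! i) 0 = int (n - i))"
    using assms
  proof (induction n arbitrary: h)
    case (Suc n)
    then obtain h' s w where h: "h = (hd h' + path_step s w) # h'" "h' \<in> paths n" by auto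
    with Suc.IH have IH: "length h' = Suc n" "\<And>i. i \<le> n \<Longrightarrow> (h' ! i) 0 = int (n - i)" by auto
    then have "hd h' 0 = int n" by (cases h') force+
    then show ?case
      using IH h by (auto simp: path_step_def nth_Cons split: nat.splits)
  qed auto
  then show "length h = Suc n" "\<And>i. i \<le> n \<Longrightarrow> (h ! i) 0 = int (n - i)" by auto
qed

lemma paths_ext:
  assumes "h \<in> paths n"
  shows "extensions h s \<subseteq> allowed h s" "card (extensions h s) = b" "finite (extensions h s)"
  using extensions_allowed[OF paths_time[OF assms]] b_pos by (auto intro: card_ge_0_finite)

lemma paths_SucE:
  assumes "h' \<in> paths (Suc n)"
  obtains h s w where "h' = (hd h + path_step s w) # h" "h \<in> paths n" "s \<in> walk_steps"
    "w \<in> lattice_ball {5..<d} t" "\<forall>c\<in>set h. hd h + path_step s w - c \<notin> D"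
proof -
  obtain h s w where h: "h' = (hd h + path_step s w) # h" "h \<in> paths n" "s \<in> walk_steps" "w \<in> extensions h s"
    using assms by auto
  then have "w \<in> allowed h s" using paths_ext(1)[OF h(2)] by blast
  then show ?thesis using that h by (auto simp: allowed_def)
qed

lemma hd_path: "h \<in> paths n \<Longrightarrow> hd h = h ! 0"
  using paths_time(1)[of h n] by (cases h) auto

lemma paths_nonempty: "h \<in> paths n \<Longrightarrow> h \<noteq> []"
  using paths_time(1)[of h n] by auto

lemma finite_paths: "finite (paths n)"
  by (induction n) (auto intro!: finite_imageI finite_SigmaI paths_ext)

lemma sum_paths_Suc:
  "(\<Sum>h'\<in>paths (Suc n). G h') =
    (\<Sum>h\<in>paths n. \<Sum>s\<in>walk_steps. \<Sum>w\<in>extensions h s. G ((hd h + path_step s w) # h))"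
proof -
  have "inj_on (\<lambda>(h, s, w). (hd h + path_step s w) # h) (SIGMA h:paths n. SIGMA s:walk_steps. extensions h s)"
  proof (rule inj_onI, clarsimp)
    fix h s w s' w'
    assume *: "h \<in> paths n" "s \<in> walk_steps" "w \<in> extensions h s" "s' \<in> walk_steps" "w' \<in> extensions h s'"
      "path_step s w = path_step s' w'"
    then have "w \<in> lattice_ball {5..<d} t" "w' \<in> lattice_ball {5..<d} t"
      using paths_ext(1)[OF *(1)] by (auto simp: allowed_def)
    with path_step_inject[OF *(6,2,4)] show "s = s' \<and> w = w'" by blast
  qed
  then show ?thesis
    by (simp add: sum.reindex sum.Sigma finite_paths paths_ext split_def)
qed

lemma card_paths: "real (card (paths n)) = (16 * real b) ^ n"
proof (induction n)
  case (Suc n)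
  have "real (card (paths (Suc n))) = (\<Sum>h'\<in>paths (Suc n). 1)" by simp
  also have "\<dots> = (\<Sum>h\<in>paths n. \<Sum>s\<in>walk_steps. \<Sum>w\<in>extensions h s. 1)" by (rule sum_paths_Suc)
  also have "\<dots> = real (card (paths n)) * (16 * real b)" by (simp add: paths_ext(2))
  finally show ?case using Suc by simp
qed simp

lemma paths_support:
  assumes "h \<in> paths n" "c \<in> set h" "i \<ge> d"
  shows "c i = 0"
  using assms(1,2)
proof (induction n arbitrary: h c)
  case (Suc n)
  from Suc.prems(1) obtain h' s w where h: "h = (hd h' + path_step s w) # h'" "h' \<in> paths n"
    "s \<in> walk_steps" "w \<in> lattice_ball {5..<d} t"
    "\<forall>c\<in>set h'. hd h' + path_step s w - c \<notin> D" by (rule paths_SucE)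
  have "hd h' i = 0"
    using Suc.IH[OF h(2), of "hd h'"] paths_nonempty[OF h(2)] by simp
  moreover have "path_step s w i = 0"
    using lattice_ball_zero[OF h(4), of i] assms(3) d_ge by (auto simp: path_step_def)
  ultimately show ?case
    using Suc h by auto
qed auto

text \<open>Walk coordinates change by 0 or 1 per unit of time. This permits the comparison of two
  paths at slightly different times.\<close>

lemma paths_walk_coord:
  assumes "h \<in> paths n" "i \<le> j" "j \<le> n" "k \<in> {1..<5}"
  shows "\<bar>(h ! i) k - (h ! j) k\<bar> \<le> int (j - i)"
  using assms(1-3)
proof (induction n arbitrary: h i j)
  case (Suc n)
  from Suc.prems(1) obtain h' s w where h: "h = (hd h' + path_step s w) # h'" "h' \<in> paths n"
    "s \<in> walk_steps" "w \<in> lattice_ball {5..<d} t"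
    "\<forall>c\<in>set h'. hd h' + path_step s w - c \<notin> D" by (rule paths_SucE)
  have s: "s k \<in> {0, 1}" using h(3) assms(4) unfolding walk_steps_def by (rule PiE_mem)
  show ?case
  proof (cases i)
    case (Suc i')
    then obtain j' where "j = Suc j'" using Suc.prems(2) by (cases j) auto
    then show ?thesis using Suc.IH[OF h(2), of i' j'] Suc Suc.prems by (simp add: h)
  next
    case 0
    show ?thesis
    proof (cases j)
      case (Suc j')
      have "\<bar>(h' ! 0) k - (h' ! j') k\<bar> \<le> int j'"
        using Suc.IH[OF h(2), of 0 j'] Suc Suc.prems by simp
      moreover have "(h ! 0) k = (h' ! 0) k + s k"
        using assms(4) by (simp add: h hd_path[OF h(2)] path_step_def)
      ultimately show ?thesis using 0 Suc s by (auto simp: h)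
    qed (simp add: 0)
  qed
qed simp

lemma D_uminus: "c - c' \<in> D \<longleftrightarrow> c' - c \<in> D"
proof -
  have "(c - c') i = 0 \<longleftrightarrow> (c' - c) i = 0" for i by auto
  moreover have "L2_set (\<lambda>i. real_of_int ((c - c') i)) {..<d} = L2_set (\<lambda>i. real_of_int ((c' - c) i)) {..<d}"
    by (simp add: L2_set_def power2_commute)
  ultimately show ?thesis
    unfolding lattice_ball_def mem_Collect_eq by presburger
qed

lemma paths_separated:
  assumes "h \<in> paths n" "c \<in> set h" "c' \<in> set h" "c \<noteq> c'"
  shows "c - c' \<notin> D"
  using assms
proof (induction n arbitrary: h c c')
  case (Suc n)
  from Suc.prems(1) obtain h' s w where h: "h = (hd h' + path_step s w) # h'" "h' \<in> paths n"
    "s \<in> walk_steps" "w \<in> lattice_ball {5..<d} t"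
    "\<forall>c\<in>set h'. hd h' + path_step s w - c \<notin> D" by (rule paths_SucE)
  define x where "x = hd h' + path_step s w"
  have "c = x \<or> c \<in> set h'" "c' = x \<or> c' \<in> set h'"
    using Suc.prems(2,3) by (simp_all add: h(1) x_def)
  moreover have "x - p \<notin> D" "p - x \<notin> D" if "p \<in> set h'" for p
    using h(5) that D_uminus by (auto simp: x_def)
  ultimately show ?case
    using Suc.IH[OF h(2)] Suc.prems(4) by metis
qed auto

lemma paths_distinct:
  assumes "h \<in> paths n"
  shows "distinct h"
  unfolding distinct_conv_nth
proof (intro allI impI)
  fix i j assume "i < length h" "j < length h" "i \<noteq> j"
  then show "h ! i \<noteq> h ! j"
    using paths_time(1)[OF assms] paths_time(2)[OF assms, of i] paths_time(2)[OF assms, of j]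
    by (metis diff_diff_cancel less_Suc_eq_le of_nat_eq_iff)
qed

end

section \<open>Mean overlap weight of two paths\<close>

lemma overlap_weight_Cons:
  "overlap_weight a e K (c # h) (c' # h') =
    (if c = c' then a else 1) * (if near K (c - c') then e else 1) * overlap_weight a e K h h'"
  by (simp add: overlap_weight_def)

lemma overlap_weight_nonneg:
  assumes "a \<ge> 0" "e \<ge> 0"
  shows "overlap_weight a e K h h' \<ge> 0"
  unfolding overlap_weight_def using assms by (intro prod_list_nonneg) auto

lemma near_cong:
  assumes "\<And>j. j \<in> {1..<5} \<Longrightarrow> v j = v' j"
  shows "near K v = near K v'"
  using assms by (auto simp: near_def)

context path_tree
begin

text \<open>If the next cubes coincide, the walk positions agree exactly, so the walks are near for
  every \<open>K\<close>; and each \<open>w\<close> coincides with at most one \<open>w'\<close>.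
  Thus at most \<open>b\<close> of the \<open>b^2\<close> pairs receive the extra
  \<open>a\<close>.\<close>

lemma sum_coincidences_le:
  assumes h: "h \<in> paths n" "h' \<in> paths n" and a: "a \<ge> (0::real)"
  shows "(\<Sum>w\<in>extensions h s. \<Sum>w'\<in>extensions h' s'.
      if hd h + path_step s w = hd h' + path_step s' w' then a else 1) \<le>
    real b ^ 2 + (if near K (hd h - hd h' + s - s') then a * real b else 0)"
proof -
  define C where "C = (\<lambda>w w'. hd h + path_step s w = hd h' + path_step s' w')"
  have inner: "(\<Sum>w'\<in>extensions h' s'. if C w w' then a else 0) \<le> (if near K (hd h - hd h' + s - s') then a else 0)" for w
  proof (cases "\<exists>w'. C w w'")
    case True
    then obtain w' where w': "C w w'" by blast
    have "near K (hd h - hd h' + s - s')"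
      unfolding near_def
    proof
      fix j :: nat assume j: "j \<in> {1..<5}"
      have "hd h j + path_step s w j = hd h' j + path_step s' w' j"
        using fun_cong[OF w'[unfolded C_def], of j] by simp
      then show "\<bar>(hd h - hd h' + s - s') j\<bar> \<le> int K"
        using j by (simp add: path_step_def)
    qed
    moreover have "(\<Sum>w'\<in>extensions h' s'. if C w w' then a else 0) = (\<Sum>w'\<in>{w' \<in> extensions h' s'. C w w'}. a)"
      by (rule sum.inter_filter[OF paths_ext(3)[OF h(2)], symmetric])
    moreover have "card {w' \<in> extensions h' s'. C w w'} \<le> Suc 0"
    proof (rule card_le_Suc0_iff_eq[THEN iffD2], use paths_ext(3)[OF h(2)] in simp, intro ballI)
      fix u u' assume u: "u \<in> {w' \<in> extensions h' s'. C w w'}" "u' \<in> {w' \<in> extensions h' s'. C w w'}"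
      then have eq: "path_step s' u = path_step s' u'" by (simp add: C_def)
      have ball: "u \<in> lattice_ball {5..<d} t" "u' \<in> lattice_ball {5..<d} t"
        using u paths_ext(1)[OF h(2)] by (auto simp: allowed_def)
      show "u = u'"
      proof
        fix j
        show "u j = u' j"
          using fun_cong[OF eq, of j] lattice_ball_zero[OF ball(1), of j] lattice_ball_zero[OF ball(2), of j]
          by (cases "j < 5") (auto simp: path_step_def)
      qed
    qed
    then have "real (card {w' \<in> extensions h' s'. C w w'}) * a \<le> 1 * a"
      using a by (intro mult_right_mono) auto
    ultimately show ?thesis by simp
  next
    case False
    then show ?thesis using a by simp
  qed
  have "(\<Sum>w\<in>extensions h s. \<Sum>w'\<in>extensions h' s'. if C w w' then a else 1) \<le>
      (\<Sum>w\<in>extensions h s. \<Sum>w'\<in>extensions h' s'. 1 + (if C w w' then a else 0))"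
    using a by (intro sum_mono) auto
  also have "\<dots> = (\<Sum>w\<in>extensions h s. real b + (\<Sum>w'\<in>extensions h' s'. if C w w' then a else 0))"
    by (simp add: sum.distrib paths_ext(2)[OF h(2)])
  also have "\<dots> \<le> (\<Sum>w\<in>extensions h s. real b + (if near K (hd h - hd h' + s - s') then a else 0))"
    by (intro sum_mono add_left_mono inner)
  also have "\<dots> = real b ^ 2 + (if near K (hd h - hd h' + s - s') then a * real b else 0)"
    by (simp add: paths_ext(2)[OF h(1)] power2_eq_square algebra_simps)
  finally show ?thesis by (simp add: C_def)
qed

text \<open>Summing over the free steps first: nearness and the value of \<open>f\<close> depend
  only on \<open>s\<close> and \<open>s'\<close>, so the inner sum merely counts coincidences. The
  resulting factor (1 + a / b) e appears only where the walks are near, is at most 1 + \<gamma>, and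
  is absorbed by the supersolution.\<close>

lemma overlap_weight_step_le:
  assumes h: "h \<in> paths n" "h' \<in> paths n"
    and a: "a \<ge> 0" "e \<ge> 1" "(1 + a / b) * e \<le> 1 + \<gamma>"
    and f: "\<And>n v. 1 \<le> f n v"
      "\<And>n v v'. (\<And>j. j \<in> {1..<5} \<Longrightarrow> v j = v' j) \<Longrightarrow> f n v = f n v'"
      "\<And>n v. (\<Sum>s\<in>walk_steps. \<Sum>s'\<in>walk_steps.
        (1 + (if near K (v + s - s') then \<gamma> else 0)) * f n (v + s - s')) \<le> 256 * f (Suc n) v"
  shows "(\<Sum>s\<in>walk_steps. \<Sum>w\<in>extensions h s. \<Sum>s'\<in>walk_steps. \<Sum>w'\<in>extensions h' s'.
      overlap_weight a e K ((hd h + path_step s w) # h) ((hd h' + path_step s' w') # h') *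
        f m ((hd h + path_step s w) - (hd h' + path_step s' w'))) \<le>
    256 * real b ^ 2 * (overlap_weight a e K h h' * f (Suc m) (hd h - hd h'))"
proof -
  define V where "V = (\<lambda>s s'. hd h - hd h' + s - s')"
  define N where "N = (\<lambda>s s'. if near K (V s s') then e else 1)"
  define \<Phi> where "\<Phi> = overlap_weight a e K h h'"
  have \<Phi>: "\<Phi> \<ge> 0" using a by (simp add: \<Phi>_def overlap_weight_nonneg)
  have coord: "((hd h + path_step s w) - (hd h' + path_step s' w')) j = V s s' j" if "j \<in> {1..<5}" for s w s' w' j
    using that by (simp add: V_def path_step_def)
  have term_eq: "overlap_weight a e K ((hd h + path_step s w) # h) ((hd h' + path_step s' w') # h') *
        f m ((hd h + path_step s w) - (hd h' + path_step s' w')) =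
      \<Phi> * N s s' * f m (V s s') * (if hd h + path_step s w = hd h' + path_step s' w' then a else 1)" for s w s' w'
  proof -
    have "near K ((hd h + path_step s w) - (hd h' + path_step s' w')) = near K (V s s')"
      by (rule near_cong[OF coord])
    moreover have "f m ((hd h + path_step s w) - (hd h' + path_step s' w')) = f m (V s s')"
      by (rule f(2)[OF coord])
    ultimately show ?thesis
      by (simp only: overlap_weight_Cons \<Phi>_def N_def mult_ac)
  qed
  have bound: "\<Phi> * N s s' * f m (V s s') * (\<Sum>w\<in>extensions h s. \<Sum>w'\<in>extensions h' s'.
      if hd h + path_step s w = hd h' + path_step s' w' then a else 1) \<le>
      real b ^ 2 * \<Phi> * ((1 + (if near K (V s s') then \<gamma> else 0)) * f m (V s s'))" for s s'
  proof -
    have "\<Phi> * N s s' * f m (V s s') * (\<Sum>w\<in>extensions h s. \<Sum>w'\<in>extensions h' s'.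
        if hd h + path_step s w = hd h' + path_step s' w' then a else 1) \<le>
      \<Phi> * N s s' * f m (V s s') * (real b ^ 2 + (if near K (V s s') then a * real b else 0))"
      using \<Phi> a f(1)[of m "V s s'"] unfolding V_def
      by (intro mult_left_mono sum_coincidences_le[OF h]) (auto simp: N_def)
    also have "\<dots> = real b ^ 2 * \<Phi> * f m (V s s') * (N s s' * (1 + (if near K (V s s') then a / real b else 0)))"
      using b_pos by (simp add: power2_eq_square algebra_simps)
    also have "\<dots> \<le> real b ^ 2 * \<Phi> * f m (V s s') * (1 + (if near K (V s s') then \<gamma> else 0))"
      using \<Phi> a f(1)[of m "V s s'"] by (intro mult_left_mono) (auto simp: N_def mult.commute)
    finally show ?thesis by (simp add: mult_ac)
  qed
  have "(\<Sum>s\<in>walk_steps. \<Sum>w\<in>extensions h s. \<Sum>s'\<in>walk_steps. \<Sum>w'\<in>extensions h' s'.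
      overlap_weight a e K ((hd h + path_step s w) # h) ((hd h' + path_step s' w') # h') *
        f m ((hd h + path_step s w) - (hd h' + path_step s' w'))) =
      (\<Sum>s\<in>walk_steps. \<Sum>s'\<in>walk_steps. \<Phi> * N s s' * f m (V s s') * (\<Sum>w\<in>extensions h s. \<Sum>w'\<in>extensions h' s'.
        if hd h + path_step s w = hd h' + path_step s' w' then a else 1))"
    unfolding term_eq sum_distrib_left by (intro sum.cong refl sum.swap)
  also have "\<dots> \<le> (\<Sum>s\<in>walk_steps. \<Sum>s'\<in>walk_steps.
      real b ^ 2 * \<Phi> * ((1 + (if near K (V s s') then \<gamma> else 0)) * f m (V s s')))"
    by (intro sum_mono bound)
  also have "\<dots> = real b ^ 2 * \<Phi> * (\<Sum>s\<in>walk_steps. \<Sum>s'\<in>walk_steps.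
      (1 + (if near K (V s s') then \<gamma> else 0)) * f m (V s s'))"
    by (simp only: sum_distrib_left)
  also have "\<dots> \<le> real b ^ 2 * \<Phi> * (256 * f (Suc m) (hd h - hd h'))"
    unfolding V_def using \<Phi> by (intro mult_left_mono f(3)) auto
  finally show ?thesis by (simp only: \<Phi>_def mult_ac)
qed

text \<open>A Feynman-Kac argument: the mean over pairs of paths of the weight times
  \<open>f\<close> at the difference of the heads does not grow when a step is added and the index
  of \<open>f\<close> is lowered by 1. There remain \<open>a * e\<close> from the common first cube
  and the upper bound 2 on \<open>f\<close>; the lower bound 1 removes \<open>f\<close> at the
  end.\<close>

lemma sum_overlap_weight_le:
  assumes a: "a \<ge> 0" "e \<ge> 1" "(1 + a / b) * e \<le> 1 + \<gamma>" and \<gamma>: "\<gamma> \<ge> 0" "4 * \<gamma> * (2 * real K + 1) ^ 4 \<le> 1"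
  shows "(\<Sum>h\<in>paths n. \<Sum>h'\<in>paths n. overlap_weight a e K h h') \<le> 2 * a * e * real (card (paths n)) ^ 2"
proof -
  obtain f :: "nat \<Rightarrow> (nat \<Rightarrow> int) \<Rightarrow> real" where f: "\<And>n v. 1 \<le> f n v" "\<And>n v. f n v \<le> 2"
    "\<And>n v v'. (\<And>j. j \<in> {1..<5} \<Longrightarrow> v j = v' j) \<Longrightarrow> f n v = f n v'"
    "\<And>n v. (\<Sum>s\<in>walk_steps. \<Sum>s'\<in>walk_steps.
        (1 + (if near K (v + s - s') then \<gamma> else 0)) * f n (v + s - s')) \<le> 256 * f (Suc n) v"
    using walk_supersolution[OF \<gamma>] by blast
  have "(\<Sum>h\<in>paths n. \<Sum>h'\<in>paths n. overlap_weight a e K h h' * f m (hd h - hd h')) \<le>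
      (256 * real b ^ 2) ^ n * (a * e * 2)" for m
  proof (induction n arbitrary: m)
    case 0
    have "near K (0 :: nat \<Rightarrow> int)" by (simp add: near_def)
    then have "overlap_weight a e K [\<lambda>_. 0] [\<lambda>_. 0] = a * e"
      by (simp add: overlap_weight_def zero_fun_def[symmetric])
    then show ?case
      using a f(2)[of m] by (auto intro!: mult_left_mono)
  next
    case (Suc n)
    have "(\<Sum>h\<in>paths (Suc n). \<Sum>h'\<in>paths (Suc n). overlap_weight a e K h h' * f m (hd h - hd h')) =
      (\<Sum>h\<in>paths n. \<Sum>s\<in>walk_steps. \<Sum>w\<in>extensions h s. \<Sum>h'\<in>paths n. \<Sum>s'\<in>walk_steps. \<Sum>w'\<in>extensions h' s'.
        overlap_weight a e K ((hd h + path_step s w) # h) ((hd h' + path_step s' w') # h') *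
        f m ((hd h + path_step s w) - (hd h' + path_step s' w')))"
      unfolding sum_paths_Suc list.sel ..
    also have "\<dots> = (\<Sum>h\<in>paths n. \<Sum>h'\<in>paths n. \<Sum>s\<in>walk_steps. \<Sum>w\<in>extensions h s. \<Sum>s'\<in>walk_steps. \<Sum>w'\<in>extensions h' s'.
        overlap_weight a e K ((hd h + path_step s w) # h) ((hd h' + path_step s' w') # h') *
        f m ((hd h + path_step s w) - (hd h' + path_step s' w')))" (is "_ = ?S")
    proof (intro sum.cong refl)
      fix h
      show "(\<Sum>s\<in>walk_steps. \<Sum>w\<in>extensions h s. \<Sum>h'\<in>paths n. G s w h') =
         (\<Sum>h'\<in>paths n. \<Sum>s\<in>walk_steps. \<Sum>w\<in>extensions h s. G s w h')" for G :: "_ \<Rightarrow> _ \<Rightarrow> _ \<Rightarrow> real"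
        by (subst (2) sum.swap) (intro sum.cong refl sum.swap)
    qed
    also have "?S \<le> (\<Sum>h\<in>paths n. \<Sum>h'\<in>paths n.
        256 * real b ^ 2 * (overlap_weight a e K h h' * f (Suc m) (hd h - hd h')))"
    proof (intro sum_mono)
      fix h h' assume hh': "h \<in> paths n" "h' \<in> paths n"
      from hh' a f(1,3,4) show "(\<Sum>s\<in>walk_steps. \<Sum>w\<in>extensions h s. \<Sum>s'\<in>walk_steps. \<Sum>w'\<in>extensions h' s'.
        overlap_weight a e K ((hd h + path_step s w) # h) ((hd h' + path_step s' w') # h') *
        f m ((hd h + path_step s w) - (hd h' + path_step s' w'))) \<le>
        256 * real b ^ 2 * (overlap_weight a e K h h' * f (Suc m) (hd h - hd h'))"
        by (rule overlap_weight_step_le)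
    qed
    also have "\<dots> = 256 * real b ^ 2 *
       (\<Sum>h\<in>paths n. \<Sum>h'\<in>paths n. overlap_weight a e K h h' * f (Suc m) (hd h - hd h'))"
      by (simp only: sum_distrib_left)
    also have "\<dots> \<le> 256 * real b ^ 2 * ((256 * real b ^ 2) ^ n * (a * e * 2))"
      by (intro mult_left_mono Suc.IH) auto
    finally show ?case by (simp only: power_Suc mult.assoc)
  qed
  note bound = this[of 0]
  have "(\<Sum>h\<in>paths n. \<Sum>h'\<in>paths n. overlap_weight a e K h h') \<le>
      (\<Sum>h\<in>paths n. \<Sum>h'\<in>paths n. overlap_weight a e K h h' * f 0 (hd h - hd h'))"
  proof (intro sum_mono)
    fix h h'
    show "overlap_weight a e K h h' \<le> overlap_weight a e K h h' * f 0 (hd h - hd h')"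
      using mult_left_mono[OF f(1) overlap_weight_nonneg] a by force
  qed
  also note bound
  also have "256 * real b ^ 2 = (16 * real b) ^ 2"
    by (simp add: power_mult_distrib)
  also have "((16 * real b) ^ 2) ^ n = real (card (paths n)) ^ 2"
    unfolding card_paths by (simp only: power_mult[symmetric] mult.commute)
  also have "real (card (paths n)) ^ 2 * (a * e * 2) = 2 * a * e * real (card (paths n)) ^ 2"
    by simp
  finally show ?thesis .
qed

section \<open>Void regions and their overlaps\<close>

definition nbhd :: "(nat \<Rightarrow> int) list \<Rightarrow> (nat \<Rightarrow> int) set" where
  "nbhd h = {c. \<exists>p\<in>set h. c - p \<in> D}"

lemma nbhd_eq: "nbhd h = (\<Union>p\<in>set h. (\<lambda>z. z + p) ` D)"
proof -
  have "c - p \<in> D \<longleftrightarrow> c \<in> (\<lambda>z. z + p) ` D" for c p :: "nat \<Rightarrow> int"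
  proof
    show "c \<in> (\<lambda>z. z + p) ` D" if "c - p \<in> D"
      by (rule image_eqI[OF _ that]) (simp only: diff_add_cancel)
    show "c - p \<in> D" if "c \<in> (\<lambda>z. z + p) ` D"
      using that by (elim imageE) (simp only: add_diff_cancel)
  qed
  then show ?thesis unfolding nbhd_def by blast
qed

lemma finite_nbhd [simp]: "finite (nbhd h)"
  by (simp add: nbhd_eq)

lemma set_subset_nbhd: "set h \<subseteq> nbhd h"
  by (auto simp: nbhd_def zero_fun_def intro!: bexI)

text \<open>A cube in both neighbourhoods is within \<open>l\<close> of some \<open>h ! i\<close>
  and some \<open>h' ! j\<close>. Then the times differ by at most 2 l, and the walks at the same
  index \<open>i\<close> by at most l + l + 2 l = 4 l, which explains \<open>K\<close>. Each such
  index accounts for at most \<open>card D\<close> common void cubes, and common path cubes have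
  equal indices because their times agree.\<close>

lemma overlap_le_weight:
  fixes a \<kappa> :: real
  assumes h: "h \<in> paths n" "h' \<in> paths n" and a: "a \<ge> 1" and \<kappa>: "\<kappa> \<ge> 0" and K: "4 * l \<le> K"
  shows "a ^ card (set h \<inter> set h') * exp (\<kappa> * card (nbhd h \<inter> nbhd h')) \<le>
    overlap_weight a (exp (\<kappa> * card D)) K h h'"
proof -
  define A where "A = {i\<in>{..<Suc n}. h ! i = h' ! i}"
  define B where "B = {i\<in>{..<Suc n}. near K (h ! i - h' ! i)}"
  have len: "length h = Suc n" "length h' = Suc n" using h paths_time by auto
  have "overlap_weight a (exp (\<kappa> * card D)) K h h' =
      (\<Prod>i<Suc n. (if h ! i = h' ! i then a else 1) * (if near K (h ! i - h' ! i) then exp (\<kappa> * card D) else 1))"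
    unfolding overlap_weight_def prod.list_conv_set_nth using len
    by (intro prod.cong) (auto simp: lessThan_atLeast0)
  also have "\<dots> = a ^ card A * exp (\<kappa> * card D) ^ card B"
    unfolding prod.distrib A_def B_def by (simp only: prod.inter_filter[symmetric] finite_lessThan prod_constant)
  finally have weight: "overlap_weight a (exp (\<kappa> * card D)) K h h' = a ^ card A * exp (\<kappa> * card D) ^ card B" .
  have "set h \<inter> set h' \<subseteq> (\<lambda>i. h ! i) ` A"
  proof
    fix c assume "c \<in> set h \<inter> set h'"
    then obtain i j where ij: "i \<le> n" "j \<le> n" "c = h ! i" "c = h' ! j"
      using len by (auto simp: in_set_conv_nth less_Suc_eq_le)
    then have "i = j"
      using paths_time(2)[OF h(1) ij(1)] paths_time(2)[OF h(2) ij(2)] by auto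
    then show "c \<in> (\<lambda>i. h ! i) ` A"
      using ij by (intro image_eqI[of _ _ i]) (auto simp: A_def)
  qed
  then have "card (set h \<inter> set h') \<le> card A"
    by (rule surj_card_le[rotated]) (simp add: A_def)
  moreover have "card (nbhd h \<inter> nbhd h') \<le> card B * card D"
  proof -
    have "nbhd h \<inter> nbhd h' \<subseteq> (\<Union>i\<in>B. (\<lambda>z. z + h ! i) ` D)"
    proof
      fix c assume c: "c \<in> nbhd h \<inter> nbhd h'"
      then obtain i j where ij: "i \<le> n" "j \<le> n" "c - h ! i \<in> D" "c - h' ! j \<in> D"
        using len by (auto simp: nbhd_def in_set_conv_nth less_Suc_eq_le)
      have coord: "\<bar>c k - (h ! i) k\<bar> \<le> int l" "\<bar>c k - (h' ! j) k\<bar> \<le> int l" if "k < 5" for k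
        using lattice_ball_coord[OF _ ij(3), of k] lattice_ball_coord[OF _ ij(4), of k] that d_ge by auto
      have "\<bar>int i - int j\<bar> \<le> 2 * int l"
        using coord[of 0] paths_time(2)[OF h(1) ij(1)] paths_time(2)[OF h(2) ij(2)] ij by auto
      have "near K (h ! i - h' ! i)"
        unfolding near_def
      proof
        fix k :: nat assume k: "k \<in> {1..<5}"
        have "\<bar>(h' ! i) k - (h' ! j) k\<bar> \<le> \<bar>int i - int j\<bar>"
        proof (cases "i \<le> j")
          case True
          then show ?thesis using paths_walk_coord[OF h(2) True ij(2) k] by simp
        next
          case False
          then show ?thesis using paths_walk_coord[OF h(2) _ ij(1) k, of j] by simp
        qed
        then show "\<bar>(h ! i - h' ! i) k\<bar> \<le> int K"
          using coord[of k] k K \<open>\<bar>int i - int j\<bar> \<le> 2 * int l\<close> by auto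
      qed
      then have "i \<in> B" using ij by (simp add: B_def)
      moreover have "c \<in> (\<lambda>z. z + h ! i) ` D"
        by (rule image_eqI[OF _ ij(3)]) (simp only: diff_add_cancel)
      ultimately show "c \<in> (\<Union>i\<in>B. (\<lambda>z. z + h ! i) ` D)" by blast
    qed
    then have "card (nbhd h \<inter> nbhd h') \<le> card (\<Union>i\<in>B. (\<lambda>z. z + h ! i) ` D)"
      by (intro card_mono) (auto simp: B_def)
    also have "\<dots> \<le> (\<Sum>i\<in>B. card ((\<lambda>z. z + h ! i) ` D))"
      by (rule card_UN_le) (simp add: B_def)
    also have "\<dots> \<le> (\<Sum>i\<in>B. card D)"
      by (intro sum_mono card_image_le) simp
    finally show ?thesis by simp
  qed
  then have "\<kappa> * card (nbhd h \<inter> nbhd h') \<le> card B * (\<kappa> * card D)"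
    using mult_left_mono[OF _ \<kappa>, of "real (card (nbhd h \<inter> nbhd h'))" "real (card B * card D)"]
    by (simp add: mult_ac del: of_nat_mult) simp
  then have "exp (\<kappa> * card (nbhd h \<inter> nbhd h')) \<le> exp (\<kappa> * card D) ^ card B"
    by (simp add: exp_of_nat_mult[symmetric])
  ultimately show ?thesis
    unfolding weight using a by (intro mult_mono power_increasing) auto
qed

end

subsection \<open>The second moment method for Poisson counts\<close>

text \<open>Cauchy-Schwarz for \<open>W\<close>, in which every event is normalised to mean 1. It is
  obtained by integrating 2 s W - W^2 \<le> s^2 on the union, outside of which \<open>W\<close>
  vanishes; s = C N is the optimal value.\<close>

lemma (in prob_space) second_moment_union:
  fixes G :: "'i \<Rightarrow> 'a set"
  assumes I: "finite I" "I \<noteq> {}" and G: "\<And>i. i \<in> I \<Longrightarrow> G i \<in> events" "\<And>i. i \<in> I \<Longrightarrow> prob (G i) > 0"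
    and C: "C > 0"
    and second: "(\<Sum>i\<in>I. \<Sum>j\<in>I. prob (G i \<inter> G j) / (prob (G i) * prob (G j))) \<le> C * real (card I) ^ 2"
  shows "prob (\<Union>i\<in>I. G i) \<ge> 1 / C"
proof -
  define A where "A = (\<Union>i\<in>I. G i)"
  define W where "W = (\<lambda>\<omega>. \<Sum>i\<in>I. indicator (G i) \<omega> / prob (G i))"
  define N where "N = real (card I)"
  define s where "s = C * N"
  have A: "A \<in> events" unfolding A_def using I G by auto
  have N: "N > 0" using I by (simp add: N_def card_gt_0_iff)
  have W2: "W \<omega> ^ 2 = (\<Sum>i\<in>I. \<Sum>j\<in>I. indicator (G i \<inter> G j) \<omega> / (prob (G i) * prob (G j)))" for \<omega>
    by (simp add: W_def power2_eq_square sum_product indicator_inter_arith)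
  have int1: "integrable M (\<lambda>\<omega>. indicator E \<omega> / c :: real)" if "E \<in> events" for E c
    using that by (intro integrable_divide_zero integrable_real_indicator) (auto simp: emeasure_eq_measure)
  have EI: "expectation (\<lambda>\<omega>. indicator E \<omega> / c) = prob E / c" if "E \<in> events" for E and c :: real
    using sets.sets_into_space[OF that] by (simp add: Int_absorb2)
  have W_int: "integrable M W"
    unfolding W_def using G by (intro Bochner_Integration.integrable_sum int1)
  have W2_int: "integrable M (\<lambda>\<omega>. W \<omega> ^ 2)"
    unfolding W2 using G by (intro Bochner_Integration.integrable_sum int1) auto
  have EW: "expectation W = N"
  proof -
    have "expectation W = (\<Sum>i\<in>I. expectation (\<lambda>\<omega>. indicator (G i) \<omega> / prob (G i)))"
      unfolding W_def using G by (intro Bochner_Integration.integral_sum int1)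
    also have "\<dots> = (\<Sum>i\<in>I. 1)"
    proof (intro sum.cong refl)
      fix i assume "i \<in> I"
      then show "expectation (\<lambda>\<omega>. indicator (G i) \<omega> / prob (G i)) = 1"
        using G[of i] by (simp add: EI)
    qed
    finally show ?thesis by (simp add: N_def)
  qed
  have EW2: "expectation (\<lambda>\<omega>. W \<omega> ^ 2) \<le> C * N ^ 2"
  proof -
    have "expectation (\<lambda>\<omega>. W \<omega> ^ 2) =
      (\<Sum>i\<in>I. \<Sum>j\<in>I. expectation (\<lambda>\<omega>. indicator (G i \<inter> G j) \<omega> / (prob (G i) * prob (G j))))"
      unfolding W2 using G
      by (subst Bochner_Integration.integral_sum; intro sum.cong refl Bochner_Integration.integral_sum
          Bochner_Integration.integrable_sum int1) auto
    also have "\<dots> = (\<Sum>i\<in>I. \<Sum>j\<in>I. prob (G i \<inter> G j) / (prob (G i) * prob (G j)))"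
    proof (intro sum.cong refl)
      fix i j assume "i \<in> I" "j \<in> I"
      then have "G i \<inter> G j \<in> events" using G by auto
      then show "expectation (\<lambda>\<omega>. indicator (G i \<inter> G j) \<omega> / (prob (G i) * prob (G j))) =
          prob (G i \<inter> G j) / (prob (G i) * prob (G j))"
        by (rule EI)
    qed
    finally show ?thesis using second by (simp add: N_def)
  qed
  have "2 * s * W \<omega> - W \<omega> ^ 2 \<le> s ^ 2 * indicator A \<omega>" for \<omega>
  proof (cases "\<omega> \<in> A")
    case True
    have "0 \<le> (s - W \<omega>) ^ 2" by simp
    then show ?thesis using True by (simp add: power2_eq_square algebra_simps)
  next
    case False
    then have "W \<omega> = 0" by (auto simp: W_def A_def intro!: sum.neutral)
    then show ?thesis using False by simp
  qed
  then have "expectation (\<lambda>\<omega>. 2 * s * W \<omega> - W \<omega> ^ 2) \<le> expectation (\<lambda>\<omega>. s ^ 2 * indicator A \<omega>)"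
    using W_int W2_int A by (intro integral_mono) (auto simp: emeasure_eq_measure)
  then have "2 * s * N - C * N ^ 2 \<le> s ^ 2 * prob A"
    using EW EW2 W_int W2_int A sets.sets_into_space[OF A] by (simp add: Int_absorb2)
  then have "(C * N ^ 2) * 1 \<le> (C * N ^ 2) * (C * prob A)"
    by (simp add: s_def power2_eq_square algebra_simps)
  moreover have "C * N ^ 2 > 0" using C N by simp
  ultimately have "1 \<le> C * prob A" by (subst (asm) mult_le_cancel_left_pos)
  then show ?thesis using C by (simp add: A_def field_simps)
qed

section \<open>Occupation probabilities of cubes\<close>

lemma grid_cell_disjoint:
  assumes "x \<in> grid_cell d h c" "x \<in> grid_cell d h c'" "\<And>i. i \<ge> d \<Longrightarrow> c i = 0" "\<And>i. i \<ge> d \<Longrightarrow> c' i = 0"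
  shows "c = c'"
proof
  fix i
  show "c i = c' i" using assms by (cases "i < d") (auto simp: grid_cell_def)
qed

text \<open>Poisson weights of the counts 0 and 1 have factorial 1: every cube involved contributes
  exp (- \<rho> h^d), every occupied one a further \<rho> h^d.\<close>

lemma prob_grid_counts:
  assumes hpp: "homogeneous_poisson_process d \<rho> M X" and h: "h > 0"
    and A: "finite A" "A \<noteq> {}" and Z: "finite Z" "A \<inter> Z = {}"
    and supp: "\<And>c i. c \<in> A \<union> Z \<Longrightarrow> i \<ge> d \<Longrightarrow> c i = 0"
  shows "measure M {\<omega> \<in> space M. (\<forall>c\<in>A. card (X \<omega> \<inter> grid_cell d h c) = 1) \<and>
      (\<forall>c\<in>Z. card (X \<omega> \<inter> grid_cell d h c) = 0)} =
    (\<rho> * h ^ d) ^ card A * exp (- (\<rho> * h ^ d) * card (A \<union> Z))"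
proof -
  interpret prob_space M using homogeneous_poisson_processD(2)[OF hpp] .
  define F where "F = A \<union> Z"
  define n where "n = card F"
  have F: "finite F" "F \<noteq> {}" using A Z by (auto simp: F_def)
  obtain g where g: "bij_betw g {..<n} F"
    using ex_bij_betw_nat_finite[OF F(1)] by (auto simp: n_def lessThan_atLeast0)
  have gF: "g i \<in> F" if "i < n" for i using g that by (auto simp: bij_betw_def)
  define k where "k = (\<lambda>c. if c \<in> A then 1 else 0 :: nat)"
  define B where "B = (\<lambda>i. grid_cell d h (g i))"
  have n: "{..<n} \<noteq> {}" using F by (auto simp: n_def card_gt_0_iff lessThan_empty_iff)
  have disj: "disjoint_family_on B {..<n}"
    unfolding disjoint_family_on_def
  proof (intro ballI impI)
    fix i j assume ij: "i \<in> {..<n}" "j \<in> {..<n}" "i \<noteq> j"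
    then have "g i \<noteq> g j" using g by (auto simp: bij_betw_def inj_on_def)
    then show "B i \<inter> B j = {}"
      using grid_cell_disjoint[of _ d h "g i" "g j"] gF ij supp by (auto simp: B_def F_def)
  qed
  have "indep_vars (\<lambda>_. count_space UNIV) (\<lambda>i \<omega>. card (X \<omega> \<inter> B i)) {..<n}"
    using homogeneous_poisson_processD(6)[OF hpp _ disj] grid_cell_bounded_borel[OF h] by (simp add: B_def)
  from indep_varsD_finite[OF this n, of "\<lambda>i. {k (g i)}"]
  have "prob (\<Inter>i<n. (\<lambda>\<omega>. card (X \<omega> \<inter> B i)) -` {k (g i)} \<inter> space M) =
      (\<Prod>i<n. prob ((\<lambda>\<omega>. card (X \<omega> \<inter> B i)) -` {k (g i)} \<inter> space M))" by simp
  also have "(\<Inter>i<n. (\<lambda>\<omega>. card (X \<omega> \<inter> B i)) -` {k (g i)} \<inter> space M) =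
      {\<omega> \<in> space M. \<forall>c\<in>F. card (X \<omega> \<inter> grid_cell d h c) = k c}"
  proof -
    have "F = g ` {..<n}" using g by (simp add: bij_betw_def)
    then have "(\<forall>i<n. card (X \<omega> \<inter> grid_cell d h (g i)) = k (g i)) \<longleftrightarrow>
        (\<forall>c\<in>F. card (X \<omega> \<inter> grid_cell d h c) = k c)" for \<omega> by auto
    moreover have "(\<Inter>i<n. (\<lambda>\<omega>. card (X \<omega> \<inter> B i)) -` {k (g i)} \<inter> space M) =
        {\<omega> \<in> space M. \<forall>i<n. card (X \<omega> \<inter> grid_cell d h (g i)) = k (g i)}"
      using n by (auto simp: B_def)
    ultimately show ?thesis by presburger
  qed
  also have "\<dots> = {\<omega> \<in> space M. (\<forall>c\<in>A. card (X \<omega> \<inter> grid_cell d h c) = 1) \<and>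
      (\<forall>c\<in>Z. card (X \<omega> \<inter> grid_cell d h c) = 0)}"
    using Z by (auto simp: F_def k_def split: if_splits)
  also have "(\<Prod>i<n. prob ((\<lambda>\<omega>. card (X \<omega> \<inter> B i)) -` {k (g i)} \<inter> space M)) =
      (\<Prod>i<n. (\<rho> * h ^ d) ^ k (g i) * exp (- (\<rho> * h ^ d)))"
  proof (intro prod.cong refl)
    fix i
    have "(\<lambda>\<omega>. card (X \<omega> \<inter> B i)) -` {k (g i)} \<inter> space M = {\<omega> \<in> space M. card (X \<omega> \<inter> B i) = k (g i)}"
      by auto
    moreover have "fact (k (g i)) = (1::real)" by (simp add: k_def)
    ultimately show "prob ((\<lambda>\<omega>. card (X \<omega> \<inter> B i)) -` {k (g i)} \<inter> space M) =
        (\<rho> * h ^ d) ^ k (g i) * exp (- (\<rho> * h ^ d))"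
      using homogeneous_poisson_processD(5)[OF hpp grid_cell_bounded_borel[OF h, of d "g i"], of "k (g i)"]
      by (simp add: B_def measure_grid_cell[OF h])
  qed
  also have "\<dots> = (\<Prod>c\<in>F. (\<rho> * h ^ d) ^ k c * exp (- (\<rho> * h ^ d)))"
    by (rule prod.reindex_bij_betw[OF g])
  also have "\<dots> = (\<rho> * h ^ d) ^ card A * exp (- (\<rho> * h ^ d) * card (A \<union> Z))"
  proof -
    have "(\<Sum>c\<in>F. k c) = card A"
      using F by (simp add: k_def sum.If_cases F_def Int_absorb1)
    then show ?thesis
      by (simp add: prod.distrib power_sum[symmetric] F_def exp_of_nat_mult[symmetric] mult.commute)
  qed
  finally show ?thesis .
qed

section \<open>Distances of points compared with those of their cubes\<close>

lemma edist_grid_cell: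
  assumes "h > 0" "x \<in> grid_cell d h c" "y \<in> grid_cell d h c'"
  shows "edist d x y \<le> h * (L2_set (\<lambda>i. real_of_int ((c - c') i)) {..<d} + sqrt d)"
    and "h * (L2_set (\<lambda>i. real_of_int ((c - c') i)) {..<d} - sqrt d) \<le> edist d x y"
proof -
  define u where "u = (\<lambda>i. x i / h - y i / h)"
  define v where "v = (\<lambda>i. real_of_int ((c - c') i))"
  have diff: "\<bar>u i - v i\<bar> \<le> 1" if "i < d" for i
  proof -
    have "\<lfloor>x i / h\<rfloor> = c i" "\<lfloor>y i / h\<rfloor> = c' i"
      using assms that by (auto simp: grid_cell_def)
    then show ?thesis unfolding u_def v_def minus_apply of_int_diff by linarith
  qed
  have "edist d x y = L2_set (\<lambda>i. h * u i) {..<d}"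
    using assms(1) by (simp add: edist_def u_def right_diff_distrib)
  then have eq: "edist d x y = h * L2_set u {..<d}"
    using assms(1) by (simp add: L2_set_right_distrib)
  have "L2_set u {..<d} \<le> L2_set v {..<d} + L2_set (\<lambda>i. u i - v i) {..<d}"
    by (rule L2_set_le_add_dist)
  moreover have "L2_set (\<lambda>i. u i - v i) {..<d} \<le> sqrt d"
    using L2_set_le_sqrt_card[of "{..<d}" "\<lambda>i. u i - v i"] diff by simp
  moreover have "L2_set v {..<d} \<le> L2_set u {..<d} + L2_set (\<lambda>i. v i - u i) {..<d}"
    by (rule L2_set_le_add_dist)
  moreover have "L2_set (\<lambda>i. v i - u i) {..<d} \<le> sqrt d"
    using L2_set_le_sqrt_card[of "{..<d}" "\<lambda>i. v i - u i"] diff by (simp add: abs_minus_commute)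
  ultimately show "edist d x y \<le> h * (L2_set (\<lambda>i. real_of_int ((c - c') i)) {..<d} + sqrt d)"
    "h * (L2_set (\<lambda>i. real_of_int ((c - c') i)) {..<d} - sqrt d) \<le> edist d x y"
    unfolding eq v_def[symmetric] using assms(1) by (auto intro!: mult_left_mono)
qed

text \<open>Time and walk change each of five coordinates by at most 1. The crude bound
  \<open>sqrt d\<close> has the same order as the rounding error of the cubes and is absorbed with
  it.\<close>

lemma L2_set_path_step_le:
  assumes "s \<in> walk_steps" "w \<in> lattice_ball {5..<d} t"
  shows "L2_set (\<lambda>i. real_of_int (path_step s w i)) {..<d} \<le> t + sqrt d"
proof -
  have "L2_set (\<lambda>i. real_of_int (path_step s w i)) {..<d} \<le> L2_set (\<lambda>i. real_of_int (w i)) {..<d} +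
      L2_set (\<lambda>i. real_of_int (path_step s w i) - real_of_int (w i)) {..<d}"
    by (rule L2_set_le_add_dist)
  moreover have "L2_set (\<lambda>i. real_of_int (path_step s w i) - real_of_int (w i)) {..<d} \<le> sqrt (card {..<d})"
  proof (rule L2_set_le_sqrt_card)
    fix i
    show "\<bar>real_of_int (path_step s w i) - real_of_int (w i)\<bar> \<le> 1"
    proof (cases "i \<in> {1..<5}")
      case True
      then have "s i \<in> {0, 1}" using assms(1) unfolding walk_steps_def by (rule PiE_mem[rotated])
      then show ?thesis using True lattice_ball_zero[OF assms(2), of i] by (auto simp: path_step_def)
    next
      case False
      then show ?thesis using lattice_ball_zero[OF assms(2), of i] by (auto simp: path_step_def)
    qed
  qed
  moreover have "L2_set (\<lambda>i. real_of_int (w i)) {..<d} = L2_set (\<lambda>i. real_of_int (w i)) {5..<d}"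
    unfolding L2_set_def using lattice_ball_zero[OF assms(2)]
    by (intro arg_cong[of _ _ sqrt] sum.mono_neutral_right) auto
  moreover have "L2_set (\<lambda>i. real_of_int (w i)) {5..<d} \<le> t"
    using assms(2) by (simp add: lattice_ball_def)
  ultimately show ?thesis by simp
qed

subsection \<open>Percolation along good paths\<close>

locale poisson_path_tree = path_tree +
  fixes \<rho> \<eta> :: real and M and X :: "'w \<Rightarrow> (nat \<Rightarrow> real) set"
  assumes hpp: "homogeneous_poisson_process d \<rho> M X" and \<eta>_pos: "\<eta> > 0"
begin

definition good :: "(nat \<Rightarrow> int) list \<Rightarrow> 'w set" where
  "good h = {\<omega> \<in> space M. (\<forall>c\<in>set h. card (X \<omega> \<inter> grid_cell d \<eta> c) = 1) \<and>
      (\<forall>c\<in>nbhd h - set h. card (X \<omega> \<inter> grid_cell d \<eta> c) = 0)}"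

abbreviation cell_rate :: real where "cell_rate \<equiv> \<rho> * \<eta> ^ d"

lemma cell_rate_pos: "cell_rate > 0"
  using homogeneous_poisson_processD(1)[OF hpp] \<eta>_pos by simp

lemma nbhd_support:
  assumes "h \<in> paths n" "c \<in> nbhd h" "i \<ge> d"
  shows "c i = 0"
proof -
  obtain p where p: "p \<in> set h" "c - p \<in> D" using assms(2) by (auto simp: nbhd_def)
  then show ?thesis
    using paths_support[OF assms(1) p(1) assms(3)] lattice_ball_zero[OF p(2), of i] assms(3) by simp
qed

lemma good_measurable: "good h \<in> sets M"
proof -
  have [measurable]: "Measurable.pred M (\<lambda>\<omega>. card (X \<omega> \<inter> grid_cell d \<eta> c) = k)" for c k
    by (intro card_measurable[OF hpp] grid_cell_bounded_borel \<eta>_pos)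
  have "finite (nbhd h - set h)" by simp
  then show ?thesis
    unfolding good_def by measurable
qed

lemma prob_good:
  assumes "h \<in> paths n"
  shows "measure M (good h) = cell_rate ^ card (set h) * exp (- cell_rate * card (nbhd h))"
proof -
  have "set h \<union> (nbhd h - set h) = nbhd h" using set_subset_nbhd by blast
  moreover have "measure M (good h) = cell_rate ^ card (set h) * exp (- cell_rate * card (set h \<union> (nbhd h - set h)))"
    unfolding good_def
    by (rule prob_grid_counts[OF hpp \<eta>_pos])
      (use paths_nonempty[OF assms] nbhd_support[OF assms] set_subset_nbhd in auto)
  ultimately show ?thesis by simp
qed

text \<open>If an occupied cube of one path lies in the void region of the other, the two events
  exclude each other; otherwise they merge into a single occupation event and equality
  holds.\<close>

lemma prob_good_Int_le:
  assumes "h \<in> paths n" "h' \<in> paths n"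
  shows "measure M (good h \<inter> good h') \<le>
    cell_rate ^ card (set h \<union> set h') * exp (- cell_rate * card (nbhd h \<union> nbhd h'))"
proof (cases "set h \<inter> (nbhd h' - set h') = {} \<and> set h' \<inter> (nbhd h - set h) = {}")
  case True
  define A where "A = set h \<union> set h'"
  define Z where "Z = (nbhd h \<union> nbhd h') - A"
  have AZ: "A \<union> Z = nbhd h \<union> nbhd h'"
    using set_subset_nbhd[of h] set_subset_nbhd[of h'] by (auto simp: A_def Z_def)
  have "good h \<inter> good h' = {\<omega> \<in> space M. (\<forall>c\<in>A. card (X \<omega> \<inter> grid_cell d \<eta> c) = 1) \<and>
      (\<forall>c\<in>Z. card (X \<omega> \<inter> grid_cell d \<eta> c) = 0)}"
    using True unfolding good_def A_def Z_def by blast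
  also have "measure M \<dots> = cell_rate ^ card A * exp (- cell_rate * card (A \<union> Z))"
  proof (rule prob_grid_counts[OF hpp \<eta>_pos])
    show "c i = 0" if "c \<in> A \<union> Z" "d \<le> i" for c i
      using that nbhd_support[OF assms(1)] nbhd_support[OF assms(2)] unfolding AZ by blast
  qed (use paths_nonempty[OF assms(1)] in \<open>auto simp: A_def Z_def\<close>)
  finally show ?thesis by (simp add: AZ) (simp add: A_def)
next
  case False
  then have "good h \<inter> good h' = {}"
    by (fastforce simp: good_def)
  then show ?thesis using cell_rate_pos by simp
qed

text \<open>Inclusion-exclusion for cubes and for neighbourhoods leaves, in the correlation ratio, a
  factor 1 / \<kappa> per common cube and exp \<kappa> per common neighbourhood cube, which the
  overlap weight dominates. The essential point is that the bound does not depend on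
  \<open>n\<close>.\<close>

lemma prob_good_paths_ge:
  assumes rate: "cell_rate \<le> 1"
    and \<gamma>: "(1 + 1 / cell_rate / b) * exp (cell_rate * card D) \<le> 1 + \<gamma>"
      "\<gamma> \<ge> 0" "4 * \<gamma> * (2 * real K + 1) ^ 4 \<le> 1" and K: "4 * l \<le> K"
  shows "measure M (\<Union>h\<in>paths n. good h) \<ge> 1 / (2 * (1 / cell_rate) * exp (cell_rate * card D))"
proof -
  interpret prob_space M using homogeneous_poisson_processD(2)[OF hpp] .
  define \<kappa> where "\<kappa> = cell_rate"
  have \<kappa>: "\<kappa> > 0" "1 / \<kappa> \<ge> 1" using cell_rate_pos rate by (auto simp: \<kappa>_def)
  have "prob (good h \<inter> good h') / (prob (good h) * prob (good h')) \<le>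
      overlap_weight (1 / \<kappa>) (exp (\<kappa> * card D)) K h h'" if h: "h \<in> paths n" "h' \<in> paths n" for h h'
  proof -
    have c1: "card (set h) + card (set h') = card (set h \<union> set h') + card (set h \<inter> set h')"
      by (intro card_Un_Int) auto
    have c2: "real (card (nbhd h)) + card (nbhd h') = card (nbhd h \<union> nbhd h') + real (card (nbhd h \<inter> nbhd h'))"
      using card_Un_Int[of "nbhd h" "nbhd h'"] by simp
    have "prob (good h) * prob (good h') = \<kappa> ^ (card (set h) + card (set h')) *
        exp (- \<kappa> * (real (card (nbhd h)) + card (nbhd h')))"
      unfolding prob_good[OF h(1)] prob_good[OF h(2)] \<kappa>_def
      by (simp add: power_add distrib_left exp_add[symmetric] algebra_simps flip: exp_add)
    also have "\<dots> = (\<kappa> ^ card (set h \<union> set h') * exp (- \<kappa> * card (nbhd h \<union> nbhd h'))) *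
        (\<kappa> ^ card (set h \<inter> set h') * exp (- (\<kappa> * card (nbhd h \<inter> nbhd h'))))"
      unfolding c1 c2 distrib_left exp_add power_add by (simp add: mult_ac)
    finally have "prob (good h \<inter> good h') / (prob (good h) * prob (good h')) \<le>
        1 / (\<kappa> ^ card (set h \<inter> set h') * exp (- (\<kappa> * card (nbhd h \<inter> nbhd h'))))"
      using prob_good_Int_le[OF h] \<kappa> by (simp add: \<kappa>_def[symmetric] divide_simps)
    also have "\<dots> = (1 / \<kappa>) ^ card (set h \<inter> set h') * exp (\<kappa> * card (nbhd h \<inter> nbhd h'))"
      by (simp add: exp_minus field_simps)
    also have "\<dots> \<le> overlap_weight (1 / \<kappa>) (exp (\<kappa> * card D)) K h h'"
      using \<kappa> by (intro overlap_le_weight[OF h] K) auto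
    finally show ?thesis .
  qed
  then have "(\<Sum>h\<in>paths n. \<Sum>h'\<in>paths n. prob (good h \<inter> good h') / (prob (good h) * prob (good h'))) \<le>
      (\<Sum>h\<in>paths n. \<Sum>h'\<in>paths n. overlap_weight (1 / \<kappa>) (exp (\<kappa> * card D)) K h h')"
    by (intro sum_mono)
  also have "\<dots> \<le> 2 * (1 / \<kappa>) * exp (\<kappa> * card D) * real (card (paths n)) ^ 2"
    using \<kappa> \<gamma> by (intro sum_overlap_weight_le[where \<gamma> = \<gamma>]) (auto simp: \<kappa>_def)
  finally have second: "(\<Sum>h\<in>paths n. \<Sum>h'\<in>paths n. prob (good h \<inter> good h') / (prob (good h) * prob (good h'))) \<le>
      2 * (1 / \<kappa>) * exp (\<kappa> * card D) * real (card (paths n)) ^ 2" .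
  have "paths n \<noteq> {}"
    using card_paths[of n] b_pos by auto
  then show ?thesis
    unfolding \<kappa>_def[symmetric]
    using second_moment_union[OF finite_paths _ good_measurable _ _ second] \<kappa> prob_good cell_rate_pos
    by simp
qed

section \<open>From good paths to an infinite component\<close>

lemma good_Cons_subset:
  assumes "h \<in> paths n" "x # h \<in> paths (Suc n)"
  shows "good (x # h) \<subseteq> good h"
proof -
  have "x \<notin> nbhd h"
    using paths_separated[OF assms(2)] paths_distinct[OF assms(2)] by (fastforce simp: nbhd_def)
  then have "nbhd h - set h \<subseteq> nbhd (x # h) - set (x # h)"
    by (auto simp: nbhd_def)
  then show ?thesis unfolding good_def by auto
qed

text \<open>Within \<open>l\<close> of \<open>c\<close> all other cubes are empty, since separation
  keeps the rest of the path away. So the cube of \<open>z\<close> is more than \<open>l\<close>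
  away, and \<open>sqrt d\<close> is lost to the positions inside the cubes.\<close>

lemma path_point_isolated:
  assumes h: "h \<in> paths n" "\<omega> \<in> good h" "c \<in> set h"
    and x: "x \<in> X \<omega> \<inter> grid_cell d \<eta> c" and z: "z \<in> X \<omega>" "z \<noteq> x"
  shows "\<eta> * (l - sqrt d) \<le> edist d x z"
proof -
  have \<omega>: "\<omega> \<in> space M" using h(2) by (simp add: good_def)
  have lf: "locally_finite d (X \<omega>)" using homogeneous_poisson_processD(3)[OF hpp \<omega>] .
  have single: "X \<omega> \<inter> grid_cell d \<eta> c = {x}"
  proof -
    have "card (X \<omega> \<inter> grid_cell d \<eta> c) = 1" using h by (simp add: good_def)
    then obtain y where "X \<omega> \<inter> grid_cell d \<eta> c = {y}" by (rule card_1_singletonE)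
    then show ?thesis using x by simp
  qed
  define p where "p = (\<lambda>i. if i < d then \<lfloor>z i / \<eta>\<rfloor> else 0)"
  have zp: "z \<in> grid_cell d \<eta> p"
    using lf z by (auto simp: grid_cell_def p_def locally_finite_def)
  have "p \<noteq> c" using single zp z by auto
  have "p - c \<notin> D"
  proof
    assume D: "p - c \<in> D"
    then have "p \<notin> set h"
      using paths_separated[OF h(1) _ h(3)] \<open>p \<noteq> c\<close> by auto
    then have "p \<in> nbhd h - set h" using D h(3) by (auto simp: nbhd_def)
    then have "card (X \<omega> \<inter> grid_cell d \<eta> p) = 0" using h(2) by (simp add: good_def)
    moreover have "finite (X \<omega> \<inter> grid_cell d \<eta> p)"
      using lf grid_cell_bounded_borel[OF \<eta>_pos, of d p] by (auto simp: locally_finite_def bounded_borel_def)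
    ultimately show False using z zp by auto
  qed
  then have "c - p \<notin> D" using D_uminus by blast
  moreover have "(c - p) i = 0" if "i \<notin> {..<d}" for i
    using paths_support[OF h(1,3), of i] that by (simp add: p_def)
  ultimately have "real l < L2_set (\<lambda>i. real_of_int ((c - p) i)) {..<d}"
    unfolding lattice_ball_def mem_Collect_eq by (meson not_le)
  then have "\<eta> * (l - sqrt d) \<le> \<eta> * (L2_set (\<lambda>i. real_of_int ((c - p) i)) {..<d} - sqrt d)"
    using \<eta>_pos by (intro mult_left_mono) auto
  also have "\<dots> \<le> edist d x z"
    using edist_grid_cell(2)[OF \<eta>_pos _ zp, of x c] x by auto
  finally show ?thesis .
qed

definition cell_point :: "'w \<Rightarrow> (nat \<Rightarrow> int) \<Rightarrow> nat \<Rightarrow> real" where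
  "cell_point \<omega> c = the_elem (X \<omega> \<inter> grid_cell d \<eta> c)"

lemma cell_point:
  assumes "\<omega> \<in> good h" "c \<in> set h"
  shows "X \<omega> \<inter> grid_cell d \<eta> c = {cell_point \<omega> c}"
proof -
  have "card (X \<omega> \<inter> grid_cell d \<eta> c) = 1" using assms by (simp add: good_def)
  then obtain y where "X \<omega> \<inter> grid_cell d \<eta> c = {y}" by (rule card_1_singletonE)
  then show ?thesis by (simp add: cell_point_def)
qed

lemma cell_point_in:
  assumes "\<omega> \<in> good h" "c \<in> set h"
  shows "cell_point \<omega> c \<in> X \<omega>" "cell_point \<omega> c \<in> grid_cell d \<eta> c"
  using cell_point[OF assms] by blast+

text \<open>The earlier point of each step reaches at least \<alpha> \<eta> (l - sqrt d), while the
  next point is at most \<eta> (t + 2 sqrt d) away: \<open>t\<close> for the free coordinates, one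
  \<open>sqrt d\<close> for time and walk, one for the positions inside the cubes.\<close>

lemma good_path_connected:
  assumes \<alpha>: "\<alpha> \<ge> 0" "t + 2 * sqrt d \<le> \<alpha> * (l - sqrt d)"
    and "h \<in> paths n" "\<omega> \<in> good h" "c \<in> set h"
  shows "(cell_point \<omega> (\<lambda>_. 0), cell_point \<omega> c) \<in> (GN1_edges d \<alpha> (X \<omega>))\<^sup>*"
  using assms(3-5)
proof (induction n arbitrary: h c)
  case (Suc n)
  from Suc.prems(1) obtain h' s w where h: "h = (hd h' + path_step s w) # h'" "h' \<in> paths n"
    "s \<in> walk_steps" "w \<in> lattice_ball {5..<d} t"
    "\<forall>c\<in>set h'. hd h' + path_step s w - c \<notin> D" by (rule paths_SucE)
  have good': "\<omega> \<in> good h'"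
    using good_Cons_subset[OF h(2), of "hd h' + path_step s w"] Suc.prems h(1) by blast
  define p q where "p = hd h'" and "q = p + path_step s w"
  have pq: "p \<in> set h" "p \<in> set h'" "q \<in> set h"
    using paths_nonempty[OF h(2)] by (auto simp: h(1) p_def q_def)
  have "q \<noteq> p"
    using paths_distinct[OF Suc.prems(1)] pq(2) by (auto simp: h(1) p_def q_def)
  have qp: "q - p = path_step s w" by (simp add: q_def)
  let ?x = "cell_point \<omega> p" and ?y = "cell_point \<omega> q"
  have x: "?x \<in> X \<omega> \<inter> grid_cell d \<eta> p" and y: "?y \<in> X \<omega> \<inter> grid_cell d \<eta> q"
    using cell_point_in[OF Suc.prems(2)] pq by auto
  have "?x \<noteq> ?y"
    using grid_cell_disjoint[of ?x d \<eta> p q] x y \<open>q \<noteq> p\<close> pq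
      paths_support[OF Suc.prems(1), of p] paths_support[OF Suc.prems(1), of q] by auto
  have "edist d ?y ?x \<le> \<eta> * (L2_set (\<lambda>i. real_of_int ((q - p) i)) {..<d} + sqrt d)"
    using edist_grid_cell(1)[OF \<eta>_pos, of ?y d q ?x p] x y by blast
  also have "\<dots> \<le> \<eta> * (t + 2 * sqrt d)"
    unfolding qp using L2_set_path_step_le[OF h(3,4)] \<eta>_pos by (intro mult_left_mono) auto
  also have "\<dots> \<le> \<eta> * (\<alpha> * (l - sqrt d))"
    using \<alpha> \<eta>_pos by (intro mult_left_mono) auto
  finally have le: "edist d ?x ?y \<le> \<alpha> * (\<eta> * (l - sqrt d))"
    by (simp add: edist_commute mult_ac)
  have "edist d ?x ?y \<le> \<alpha> * edist d ?x z" if "z \<in> X \<omega> - {?x}" for z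
  proof -
    have "\<eta> * (l - sqrt d) \<le> edist d ?x z"
      by (rule path_point_isolated[OF Suc.prems(1,2) pq(1) x]) (use that in auto)
    from mult_left_mono[OF this \<alpha>(1)] le show ?thesis by linarith
  qed
  then have "(?x, ?y) \<in> GN1_edges d \<alpha> (X \<omega>)"
    using x y \<open>?x \<noteq> ?y\<close> by (simp add: GN1_edges_iff[OF \<alpha>(1)])
  moreover have IH: "(cell_point \<omega> (\<lambda>_. 0), cell_point \<omega> c) \<in> (GN1_edges d \<alpha> (X \<omega>))\<^sup>*" if "c \<in> set h'" for c
    using Suc.IH[OF h(2) good' that] .
  ultimately have "(cell_point \<omega> (\<lambda>_. 0), ?y) \<in> (GN1_edges d \<alpha> (X \<omega>))\<^sup>*"
    using pq(2) by (meson rtrancl.rtrancl_into_rtrancl)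
  then show ?case
    using IH Suc.prems(3) by (auto simp: h(1) p_def q_def)
qed simp

text \<open>No infinite path is extracted. If the cluster \<open>C\<close> of the starting point
  were finite, a path in \<open>paths (card C)\<close> would have card C + 1 distinct cubes and so
  too many points in \<open>C\<close>.\<close>

lemma good_paths_percolation:
  assumes \<alpha>: "\<alpha> \<ge> 0" "t + 2 * sqrt d \<le> \<alpha> * (l - sqrt d)"
  shows "(\<Inter>n. \<Union>h\<in>paths n. good h) \<subseteq> percolation_event d \<alpha> M X"
proof
  fix \<omega> assume *: "\<omega> \<in> (\<Inter>n. \<Union>h\<in>paths n. good h)"
  define C where "C = {y \<in> X \<omega>. (cell_point \<omega> (\<lambda>_. 0), y) \<in> (GN1_edges d \<alpha> (X \<omega>))\<^sup>*}"
  have "\<omega> \<in> good [\<lambda>_. 0]"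
    using *[THEN INT_D, of 0] by simp
  then have 0: "cell_point \<omega> (\<lambda>_. 0) \<in> X \<omega>"
    by (rule cell_point_in) simp
  have \<omega>: "\<omega> \<in> space M"
    using \<open>\<omega> \<in> good [\<lambda>_. 0]\<close> unfolding good_def by blast
  have "infinite C"
  proof
    assume fin: "finite C"
    obtain h where h: "h \<in> paths (card C)" "\<omega> \<in> good h"
      using * by blast
    have "cell_point \<omega> ` set h \<subseteq> C"
      using good_path_connected[OF \<alpha> h] cell_point_in(1)[OF h(2)] by (auto simp: C_def)
    moreover have "inj_on (cell_point \<omega>) (set h)"
    proof (rule inj_onI)
      fix c c' assume c: "c \<in> set h" "c' \<in> set h" "cell_point \<omega> c = cell_point \<omega> c'"
      show "c = c'"
        using cell_point_in(2)[OF h(2) c(1)] cell_point_in(2)[OF h(2) c(2), folded c(3)]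
          paths_support[OF h(1) c(1)] paths_support[OF h(1) c(2)]
        by (rule grid_cell_disjoint)
    qed
    ultimately have "card (set h) \<le> card C"
      using fin card_image card_mono by metis
    then show False
      using distinct_card[OF paths_distinct[OF h(1)]] paths_time(1)[OF h(1)] by simp
  qed
  then show "\<omega> \<in> percolation_event d \<alpha> M X"
    using \<omega> 0 unfolding percolation_event_def mem_Collect_eq ex_infinite_component_iff C_def by blast
qed

lemma percolation_event_pos:
  assumes \<alpha>: "\<alpha> \<ge> 0" "t + 2 * sqrt d \<le> \<alpha> * (l - sqrt d)"
    and rate: "cell_rate \<le> 1"
    and \<gamma>: "(1 + 1 / cell_rate / b) * exp (cell_rate * card D) \<le> 1 + \<gamma>"
      "\<gamma> \<ge> 0" "4 * \<gamma> * (2 * real K + 1) ^ 4 \<le> 1" and K: "4 * l \<le> K"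
  shows "measure M (percolation_event d \<alpha> M X) > 0"
proof -
  interpret prob_space M using homogeneous_poisson_processD(2)[OF hpp] .
  define A where "A = (\<lambda>n. \<Union>h\<in>paths n. good h)"
  define c where "c = 1 / (2 * (1 / cell_rate) * exp (cell_rate * card D))"
  have "c > 0" using cell_rate_pos by (simp add: c_def)
  have A: "A n \<in> events" for n
    unfolding A_def using finite_paths good_measurable by auto
  have "decseq A"
  proof (rule decseq_SucI)
    fix n
    show "A (Suc n) \<subseteq> A n"
    proof
      fix \<omega> assume "\<omega> \<in> A (Suc n)"
      then obtain h' where h': "h' \<in> paths (Suc n)" "\<omega> \<in> good h'" unfolding A_def by blast
      from h'(1) obtain h s w where h: "h' = (hd h + path_step s w) # h" "h \<in> paths n"
        "s \<in> walk_steps" "w \<in> lattice_ball {5..<d} t"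
        "\<forall>c\<in>set h. hd h + path_step s w - c \<notin> D" by (rule paths_SucE)
      then have "\<omega> \<in> good h"
        using good_Cons_subset[OF h(2)] h' by blast
      then show "\<omega> \<in> A n" using h(2) unfolding A_def by blast
    qed
  qed
  then have "(\<lambda>n. prob (A n)) \<longlonglongrightarrow> prob (\<Inter>n. A n)"
    using A by (intro finite_Lim_measure_decseq) auto
  moreover have "c \<le> prob (A n)" for n
    unfolding A_def c_def by (rule prob_good_paths_ge[OF rate \<gamma> K])
  ultimately have "c \<le> prob (\<Inter>n. A n)"
    by (intro LIMSEQ_le_const) auto
  also have "\<dots> \<le> prob (percolation_event d \<alpha> M X)"
    using good_paths_percolation[OF \<alpha>] percolation_event_measurable[OF hpp \<alpha>(1)]
    by (intro finite_measure_mono) (auto simp: A_def)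
  finally show ?thesis using \<open>c > 0\<close> by linarith
qed

end

subsection \<open>Choice of the parameters\<close>

lemma percolation_event_pos_parameters:
  fixes \<epsilon> :: real
  assumes hpp: "homogeneous_poisson_process d \<rho> M X"
    and \<epsilon>: "0 < \<epsilon>" "\<epsilon> \<le> 1" and d: "6 \<le> d" and l: "l = nat \<lceil>13 * sqrt d / \<epsilon>\<rceil>"
    and growth: "2000 * (8 * real l + 1) ^ 8 * (2 * real l + 1) ^ 5 \<le> (1 + \<epsilon> / 2) ^ (d - 5)"
  shows "measure M (percolation_event d (1 + \<epsilon>) M X) > 0"
proof -
  define \<theta> where "\<theta> = 1 + \<epsilon> / 2"
  \<comment> \<open>The largest \<open>t\<close> for which the next point is within reach at
    \<alpha> = 1 + \<epsilon>.\<close>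
  define t where "t = (1 + \<epsilon>) * (real l - sqrt d) - 2 * sqrt d"
  define k where "k = card (lattice_ball {5..<d} (real l))"
  define x where "x = card (lattice_ball {..<d} (real l))"
  define y where "y = card (lattice_ball {5..<d} t)"
  \<comment> \<open>The side 2 K + 1 of the box of near differences, for K = 4 l.\<close>
  define L where "L = 8 * real l + 1"
  have L: "L \<ge> 1" by (simp add: L_def)
  have \<rho>: "\<rho> > 0" using homogeneous_poisson_processD(1)[OF hpp] .
  have l_ge: "13 * sqrt d \<le> \<epsilon> * l"
  proof -
    have "13 * sqrt d / \<epsilon> \<le> l" unfolding l by (simp add: real_nat_ceiling_ge)
    then show ?thesis using \<epsilon> by (simp add: field_simps)
  qed
  have "\<theta> ^ (d - 5) * k \<le> y"
  proof -
    have "sqrt (real (d - 5)) \<le> sqrt d" by simp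
    then have "\<theta> * (l + sqrt (real (d - 5))) \<le> \<theta> * (l + sqrt d)"
      using \<epsilon> by (intro mult_left_mono) (auto simp: \<theta>_def)
    also have "\<dots> \<le> t - sqrt d"
    proof -
      \<comment> \<open>Origin of the 13 = 2 (5 + 3/2): half of \<epsilon> l has to cover 5 sqrt d
        and (3/2) \<epsilon> sqrt d.\<close>
      have "\<epsilon> * sqrt d \<le> 1 * sqrt d" using \<epsilon> by (intro mult_right_mono) auto
      moreover have "t - sqrt d - \<theta> * (l + sqrt d) = \<epsilon> * l / 2 - 5 * sqrt d - 3 / 2 * (\<epsilon> * sqrt d)"
        by (simp add: t_def \<theta>_def field_simps)
      ultimately show ?thesis using l_ge by linarith
    qed
    also have "\<dots> \<le> t - sqrt (real (d - 5))" by simp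
    finally show ?thesis
      using card_lattice_ball_scale[of "{5..<d}" "real l" \<theta> t] d \<epsilon>
      by (simp add: \<theta>_def k_def y_def)
  qed
  moreover have "x \<le> (2 * l + 1) ^ 5 * k"
    unfolding x_def k_def using d by (intro card_lattice_ball_project) simp
  then have "real x \<le> (2 * real l + 1) ^ 5 * k"
    using of_nat_mono[of x "(2 * l + 1) ^ 5 * k", where 'a = real] by (simp add: add.commute)
  then have "2000 * L ^ 8 * x \<le> 2000 * L ^ 8 * ((2 * real l + 1) ^ 5 * k)"
    using L by (intro mult_left_mono) auto
  moreover have "2000 * L ^ 8 * (2 * real l + 1) ^ 5 * k \<le> \<theta> ^ (d - 5) * k"
    using growth by (intro mult_right_mono) (auto simp: L_def \<theta>_def)
  ultimately have xy: "2000 * L ^ 8 * real x \<le> real y" by linarith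
  have x: "x > 0"
  proof -
    have "(\<lambda>_. 0) \<in> lattice_ball {..<d} (real l)" by simp
    then have "lattice_ball {..<d} (real l) \<noteq> {}" by blast
    then show ?thesis by (simp add: x_def card_gt_0_iff)
  qed
  have L8: "L ^ 8 \<ge> L" using power_increasing[of 1 8 L] L by simp
  have "2000 * L * real x \<le> 2000 * L ^ 8 * real x"
    using L8 by (intro mult_right_mono) auto
  then have xy': "2000 * L * real x \<le> real y" using xy by linarith
  have "2000 * 1 * 1 \<le> 2000 * L * real x"
    using L x by (intro mult_mono) auto
  then have y: "y \<ge> 2000" using xy' by linarith
  \<comment> \<open>At most half of the steps are forbidden, as 2 l x \<le> y is shown below;
    rounding down still leaves y / 3.\<close>
  define b where "b = y div 2"
  have b: "real b \<ge> y / 3" "b > 0" using y by (auto simp: b_def)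
  have "real (2 * (l * x)) \<le> 2000 * L * real x"
  proof -
    have "2 * real l * x \<le> 2000 * L * real x"
      by (intro mult_right_mono) (auto simp: L_def)
    then show ?thesis by simp
  qed
  then have "2 * (l * x) \<le> y"
    using xy' by linarith
  then have room: "b + l * x \<le> y" by (simp add: b_def)
  \<comment> \<open>The mean number of points per cube will be 1 / q. The geometric mean equalises
    the two errors: void regions contribute x / q = s, coincidences q / b \<le> 3 s.\<close>
  define q where "q = sqrt (real x * real y)"
  have q: "q \<ge> 1" "q * q = real x * real y"
  proof -
    have "1 * 1 \<le> real x * real y" using x y by (intro mult_mono) auto
    then show "q \<ge> 1" by (simp add: q_def)
  qed (simp add: q_def)
  define s where "s = real x / q"
  have s_eq: "s = q / y" using q y by (simp add: s_def field_simps)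
  have s_pos: "s > 0" using x q by (simp add: s_def)
  have "s ^ 2 = s * (q / y)" by (simp only: power2_eq_square flip: s_eq)
  also have "\<dots> = real x / real y" using q by (simp add: s_def)
  finally have s2: "s ^ 2 = real x / real y" .
  \<comment> \<open>44 = 4 * 11 is the condition on \<gamma> = 11 s; its square 1936 is rounded up
    to the 2000 of the growth hypothesis.\<close>
  have s_le: "44 * s * L ^ 4 \<le> 1"
  proof -
    have "(44 * s * L ^ 4) ^ 2 = 1936 * L ^ 8 * (s ^ 2)"
      by (simp add: power_mult_distrib flip: power_mult)
    also have "\<dots> \<le> 2000 * L ^ 8 * (s ^ 2)"
      using L by (intro mult_right_mono) auto
    also have "\<dots> \<le> 1 ^ 2"
      unfolding s2 using xy y by (simp add: field_simps)
    finally show ?thesis by (rule power2_le_imp_le) simp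
  qed
  have "s * 1 \<le> s * L ^ 4" using s_pos L by (intro mult_left_mono) auto
  then have s1: "s \<le> 1" using s_le s_pos by linarith
  \<comment> \<open>The side of the cubes absorbs the density.\<close>
  define \<eta> where "\<eta> = root d (1 / q / \<rho>)"
  have \<eta>: "\<eta> > 0" "\<rho> * \<eta> ^ d = 1 / q"
    using q \<rho> d by (auto simp: \<eta>_def)
  interpret poisson_path_tree d l b t \<rho> \<eta> M X
    using room b d hpp \<eta> by unfold_locales (auto simp: x_def y_def)
  have "(1 + 1 / (1 / q) / b) * exp ((1 / q) * x) \<le> 1 + 11 * s"
  proof -
    have "q / b \<le> q / (y / 3)" using q b y by (intro divide_left_mono) auto
    then have "1 + 1 / (1 / q) / b \<le> 1 + 3 * s" by (simp add: s_eq mult.commute)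
    moreover have "exp ((1 / q) * x) \<le> 1 + s + s ^ 2"
      using exp_bound[of s] s_pos s1 by (simp add: s_def)
    ultimately have "(1 + 1 / (1 / q) / b) * exp ((1 / q) * x) \<le> (1 + 3 * s) * (1 + s + s ^ 2)"
      using s_pos by (intro mult_mono) auto
    also have "\<dots> = 1 + 4 * s + 4 * s ^ 2 + 3 * s ^ 3"
      by (simp add: power2_eq_square power3_eq_cube algebra_simps)
    \<comment> \<open>Since s \<le> 1, all powers are bounded by \<open>s\<close>, and 4 + 4 + 3 =
      11.\<close>
    also have "\<dots> \<le> 1 + 11 * s"
      using power_decreasing[of 1 2 s] power_decreasing[of 1 3 s] s_pos s1 by simp
    finally show ?thesis .
  qed
  then have *: "(1 + 1 / (\<rho> * \<eta> ^ d) / b) * exp ((\<rho> * \<eta> ^ d) * card D) \<le> 1 + 11 * s"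
    unfolding \<eta>(2) x_def .
  have **: "4 * (11 * s) * (2 * real (4 * l) + 1) ^ 4 \<le> 1"
    using s_le by (simp add: L_def)
  show ?thesis
  proof (rule percolation_event_pos[OF _ _ _ * _ **])
    show "t + 2 * sqrt d \<le> (1 + \<epsilon>) * (l - sqrt d)" by (simp add: t_def)
    show "\<rho> * \<eta> ^ d \<le> 1" unfolding \<eta>(2) using q by simp
  qed (use \<epsilon> s_pos in auto)
qed

text \<open>An exponential in \<open>d\<close> beats a polynomial in sqrt d. The ceiling is first
  bounded by an explicit function, and multiplying by \<open>\<theta> ^ 5\<close> avoids the
  truncated difference d - 5.\<close>

lemma growth_eventually:
  fixes \<epsilon> :: real
  assumes "\<epsilon> > 0"
  shows "\<forall>\<^sub>F d in sequentially. 2000 * (8 * real (nat \<lceil>13 * sqrt d / \<epsilon>\<rceil>) + 1) ^ 8 *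
    (2 * real (nat \<lceil>13 * sqrt d / \<epsilon>\<rceil>) + 1) ^ 5 \<le> (1 + \<epsilon> / 2) ^ (d - 5)"
proof -
  define \<theta> where "\<theta> = 1 + \<epsilon> / 2"
  define a where "a = 13 / \<epsilon>"
  have "\<theta> > 1" "a > 0" using assms by (simp_all add: \<theta>_def a_def)
  then have "\<forall>\<^sub>F d::nat in sequentially.
      2000 * (8 * (a * sqrt d + 1) + 1) ^ 8 * (2 * (a * sqrt d + 1) + 1) ^ 5 * \<theta> ^ 5 \<le> \<theta> ^ d"
    by real_asymp
  then show ?thesis
    using eventually_ge_at_top[of "5::nat"]
  proof eventually_elim
    case (elim d)
    define l where "l = real (nat \<lceil>13 * sqrt d / \<epsilon>\<rceil>)"
    have "13 * sqrt d / \<epsilon> \<ge> 0" using assms by simp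
    then have l: "0 \<le> l" "l \<le> a * sqrt d + 1"
      unfolding l_def a_def using of_int_ceiling_le_add_one[of "13 * sqrt d / \<epsilon>"] by auto
    have "2000 * (8 * l + 1) ^ 8 * (2 * l + 1) ^ 5 * \<theta> ^ 5 \<le>
        2000 * (8 * (a * sqrt d + 1) + 1) ^ 8 * (2 * (a * sqrt d + 1) + 1) ^ 5 * \<theta> ^ 5"
      using l \<open>\<theta> > 1\<close> by (intro mult_mono power_mono) auto
    also have "\<dots> \<le> \<theta> ^ d" by (rule elim(1))
    also have "\<dots> = \<theta> ^ (d - 5) * \<theta> ^ 5"
      using elim(2) by (simp flip: power_add)
    finally show ?case
      using \<open>\<theta> > 1\<close> unfolding l_def[symmetric] \<theta>_def[symmetric] by (subst (asm) mult_le_cancel_right_pos) auto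
  qed
qed

theorem theorem4p3:
  fixes M :: "nat \<Rightarrow> 'w measure"
    and X :: "nat \<Rightarrow> 'w \<Rightarrow> (nat \<Rightarrow> real) set"
    and dens :: "nat \<Rightarrow> real"
  assumes "\<And>d. d \<ge> 1 \<Longrightarrow> homogeneous_poisson_process d (dens d) (M d) (X d)"
  shows "(\<lambda>d. critical_value d (M d) (X d)) \<longlonglongrightarrow> 1"
proof (rule order_tendstoI)
  fix a :: ereal assume "a < 1"
  show "\<forall>\<^sub>F d in sequentially. a < critical_value d (M d) (X d)"
    using eventually_ge_at_top[of 1]
  proof eventually_elim
    case (elim d)
    then show ?case
      using critical_value_ge_1[OF assms[of d]] \<open>a < 1\<close> by (auto intro: less_le_trans)
  qed
next
  fix a :: ereal assume "1 < a"
  then obtain r where r: "1 < ereal r" "ereal r < a"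
    using ereal_dense2 by blast
  \<comment> \<open>The cap at 1 meets the requirement of the parameter choice; a smaller \<epsilon>
    only strengthens the bound.\<close>
  define \<epsilon> where "\<epsilon> = min (r - 1) 1"
  have \<epsilon>: "0 < \<epsilon>" "\<epsilon> \<le> 1" "1 + \<epsilon> \<le> r" using r by (auto simp: \<epsilon>_def one_ereal_def)
  show "\<forall>\<^sub>F d in sequentially. critical_value d (M d) (X d) < a"
    using growth_eventually[OF \<epsilon>(1)] eventually_ge_at_top[of 6]
  proof eventually_elim
    case (elim d)
    then have "critical_value d (M d) (X d) \<le> ereal (1 + \<epsilon>)"
      using percolation_event_pos_parameters[OF assms \<epsilon>(1,2) _ refl] \<epsilon>
      by (intro critical_value_le) auto
    also have "\<dots> \<le> ereal r" using \<epsilon> by simp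
    also have "\<dots> < a" by (rule r)
    finally show ?case .
  qed
qed

end
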